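(* Work in ZFC and consider set-theoretic rank potentialism $\mathcal{V}=\{V_\beta\mid\beta\in\mathrm{Ord}\}$. There are worlds $V_\beta$ with $$\mathrm{S4.3}=\mathrm{Val}_{\mathcal{V}}(V_\beta,\mathcal{L}^\Diamond_{\in,V_\beta})=\mathrm{Val}_{\mathcal{V}}(V_\beta,\mathcal{L}_\in).$$
   Context: $\mathcal{V}$ is the potentialist system whose worlds are the rank-initial segments $V_\beta$, with $V_\beta$ accessing $V_\delta$ iff $\beta\le\delta$; $\Diamond\varphi$ at $V_\beta$ means $\varphi$ holds at some $V_\delta$, $\delta\ge\beta$, and $\Box\varphi$ means at all such; quantifiers range over the current world. $\mathcal{L}_\in$ is the language of set theory, $\mathcal{L}_\in^\Diamond$ adds modal operators, a subscript $V_\beta$ means parameters from $V_\beta$ are allowed. $\mathrm{Val}_{\mathcal{V}}(W,\mathcal{L}')$ is the set of propositional modal formulas all of whose substitution instances by $\mathcal{L}'$-sentences (propositional variables replaced by sentences) are true at $W$. *)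

theory Defs
  imports Main
begin

section \<open>Propositional modal logic and S4.3\<close>

datatype pmf = PVar nat | PBot | PImp pmf pmf | PBox pmf

abbreviation PNeg :: "pmf \<Rightarrow> pmf" where
  "PNeg p \<equiv> PImp p PBot"

abbreviation POr :: "pmf \<Rightarrow> pmf \<Rightarrow> pmf" where
  "POr p q \<equiv> PImp (PNeg p) q"

abbreviation PAnd :: "pmf \<Rightarrow> pmf \<Rightarrow> pmf" where
  "PAnd p q \<equiv> PNeg (PImp p (PNeg q))"

abbreviation PDia :: "pmf \<Rightarrow> pmf" where
  "PDia p \<equiv> PNeg (PBox (PNeg p))"

text \<open>The first three axiom schemes, with modus ponens, generate exactly the classical
  tautologies over implication and falsum. Since the axioms are schemes, the set is closed
  under uniform substitution.\<close>

inductive_set S43 :: "pmf set" where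
  prop_K: "PImp p (PImp q p) \<in> S43"
| prop_S: "PImp (PImp p (PImp q r)) (PImp (PImp p q) (PImp p r)) \<in> S43"
| prop_DN: "PImp (PNeg (PNeg p)) p \<in> S43"
| ax_K: "PImp (PBox (PImp p q)) (PImp (PBox p) (PBox q)) \<in> S43"
| ax_T: "PImp (PBox p) p \<in> S43"
| ax_4: "PImp (PBox p) (PBox (PBox p)) \<in> S43"
| ax_3: "PImp (PAnd (PDia p) (PDia q))
           (PDia (POr (PAnd p (PDia q)) (PAnd q (PDia p)))) \<in> S43"
| MP: "PImp p q \<in> S43 \<Longrightarrow> p \<in> S43 \<Longrightarrow> q \<in> S43"
| Nec: "p \<in> S43 \<Longrightarrow> PBox p \<in> S43"


section \<open>The modal language of set theory with parameters\<close>

datatype (tparams: 'a) trm = Var nat | Par 'a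

text \<open>The set function \<open>params\<close> generated by the datatype package collects the
  parameters \<open>Par a\<close> occurring in a formula.\<close>

datatype (params: 'a) fml =
    Mem "'a trm" "'a trm"
  | Eql "'a trm" "'a trm"
  | Bot
  | Imp "'a fml" "'a fml"
  | Forall nat "'a fml"
  | Box "'a fml"

abbreviation Neg :: "'a fml \<Rightarrow> 'a fml" where
  "Neg \<phi> \<equiv> Imp \<phi> Bot"

abbreviation Dia :: "'a fml \<Rightarrow> 'a fml" where
  "Dia \<phi> \<equiv> Neg (Box (Neg \<phi>))"

primrec tvars :: "'a trm \<Rightarrow> nat set" where
  "tvars (Var n) = {n}"
| "tvars (Par a) = {}"

primrec fvars :: "'a fml \<Rightarrow> nat set" where
  "fvars (Mem t u) = tvars t \<union> tvars u"
| "fvars (Eql t u) = tvars t \<union> tvars u"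
| "fvars Bot = {}"
| "fvars (Imp \<phi> \<psi>) = fvars \<phi> \<union> fvars \<psi>"
| "fvars (Forall n \<phi>) = fvars \<phi> - {n}"
| "fvars (Box \<phi>) = fvars \<phi>"

primrec nonmodal :: "'a fml \<Rightarrow> bool" where
  "nonmodal (Mem t u) = True"
| "nonmodal (Eql t u) = True"
| "nonmodal Bot = True"
| "nonmodal (Imp \<phi> \<psi>) = (nonmodal \<phi> \<and> nonmodal \<psi>)"
| "nonmodal (Forall n \<phi>) = nonmodal \<phi>"
| "nonmodal (Box \<phi>) = False"

text \<open>\<open>E\<close> is the membership relation of the ambient universe, \<open>D w\<close> the domain of
  world \<open>w\<close>, and \<open>R\<close> the accessibility relation.\<close>

primrec tval :: "(nat \<Rightarrow> 'a) \<Rightarrow> 'a trm \<Rightarrow> 'a" where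
  "tval s (Var n) = s n"
| "tval s (Par a) = a"

primrec sat :: "('a \<Rightarrow> 'a \<Rightarrow> bool) \<Rightarrow> ('w \<Rightarrow> 'a set) \<Rightarrow> ('w \<Rightarrow> 'w \<Rightarrow> bool)
    \<Rightarrow> 'w \<Rightarrow> (nat \<Rightarrow> 'a) \<Rightarrow> 'a fml \<Rightarrow> bool" where
  "sat E D R w s (Mem t u) = E (tval s t) (tval s u)"
| "sat E D R w s (Eql t u) = (tval s t = tval s u)"
| "sat E D R w s Bot = False"
| "sat E D R w s (Imp \<phi> \<psi>) = (sat E D R w s \<phi> \<longrightarrow> sat E D R w s \<psi>)"
| "sat E D R w s (Forall n \<phi>) = (\<forall>x\<in>D w. sat E D R w (s(n := x)) \<phi>)"
| "sat E D R w s (Box \<phi>) = (\<forall>v. R w v \<longrightarrow> sat E D R v s \<phi>)"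

lemma sat_Dia: "sat E D R w s (Dia \<phi>) \<longleftrightarrow> (\<exists>v. R w v \<and> sat E D R v s \<phi>)"
  by simp

primrec inst :: "(nat \<Rightarrow> 'a fml) \<Rightarrow> pmf \<Rightarrow> 'a fml" where
  "inst \<sigma> (PVar n) = \<sigma> n"
| "inst \<sigma> PBot = Bot"
| "inst \<sigma> (PImp p q) = Imp (inst \<sigma> p) (inst \<sigma> q)"
| "inst \<sigma> (PBox p) = Box (inst \<sigma> p)"

text \<open>Substitution instances by sentences are sentences, so the assignment \<open>s\<close> below is
  immaterial; it takes values in the whole type because a world may have empty domain.\<close>

definition Val :: "('a \<Rightarrow> 'a \<Rightarrow> bool) \<Rightarrow> ('w \<Rightarrow> 'a set) \<Rightarrow> ('w \<Rightarrow> 'w \<Rightarrow> bool)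
    \<Rightarrow> 'w \<Rightarrow> 'a fml set \<Rightarrow> pmf set" where
  "Val E D R w L = {p. \<forall>\<sigma>. (\<forall>n. \<sigma> n \<in> L) \<longrightarrow> (\<forall>s. sat E D R w s (inst \<sigma> p))}"

definition L_set :: "'a fml set" where
  "L_set = {\<phi>. fvars \<phi> = {} \<and> nonmodal \<phi> \<and> params \<phi> = {}}"

definition L_set_dia :: "'a set \<Rightarrow> 'a fml set" where
  "L_set_dia A = {\<phi>. fvars \<phi> = {} \<and> params \<phi> \<subseteq> A}"


section \<open>Models of ZFC\<close>

text \<open>Satisfaction in the whole universe; only meaningful for nonmodal formulas.\<close>

definition fo_sat :: "('a \<Rightarrow> 'a \<Rightarrow> bool) \<Rightarrow> (nat \<Rightarrow> 'a) \<Rightarrow> 'a fml \<Rightarrow> bool" where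
  "fo_sat E s \<phi> = sat E (\<lambda>_. UNIV) (\<lambda>_ _. False) () s \<phi>"

text \<open>First-order ZFC: the model need not be well-founded or a standard model, and the two
  schemes range over formulas of the language of set theory. Variables other than the
  designated ones serve as parameters, through the assignment \<open>s\<close>.\<close>

locale ZFC =
  fixes E :: "'a \<Rightarrow> 'a \<Rightarrow> bool"
  assumes extensionality: "(\<And>x. E x a \<longleftrightarrow> E x b) \<Longrightarrow> a = b"
    and foundation: "E x a \<Longrightarrow> \<exists>y. E y a \<and> \<not> (\<exists>z. E z y \<and> E z a)"
    and pairing: "\<exists>c. \<forall>x. E x c \<longleftrightarrow> x = a \<or> x = b"
    and union: "\<exists>b. \<forall>x. E x b \<longleftrightarrow> (\<exists>y. E x y \<and> E y a)"
    and powerset: "\<exists>b. \<forall>x. E x b \<longleftrightarrow> (\<forall>y. E y x \<longrightarrow> E y a)"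
    and infinity: "\<exists>a. (\<exists>e. E e a \<and> (\<forall>x. \<not> E x e)) \<and>
        (\<forall>x. E x a \<longrightarrow> (\<exists>y. E y a \<and> (\<forall>z. E z y \<longleftrightarrow> E z x \<or> z = x)))"
    and separation: "nonmodal \<phi> \<Longrightarrow> params \<phi> = {} \<Longrightarrow>
        \<exists>b. \<forall>x. E x b \<longleftrightarrow> E x a \<and> fo_sat E (s(0 := x)) \<phi>"
    and replacement: "nonmodal \<phi> \<Longrightarrow> params \<phi> = {} \<Longrightarrow>
        (\<And>x. E x a \<Longrightarrow> \<exists>!y. fo_sat E (s(0 := x, 1 := y)) \<phi>) \<Longrightarrow>
        \<exists>b. \<forall>y. E y b \<longleftrightarrow> (\<exists>x. E x a \<and> fo_sat E (s(0 := x, 1 := y)) \<phi>)"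
    and choice: "(\<And>x. E x a \<Longrightarrow> \<exists>y. E y x) \<Longrightarrow>
        (\<And>x y z. E x a \<Longrightarrow> E y a \<Longrightarrow> E z x \<Longrightarrow> E z y \<Longrightarrow> x = y) \<Longrightarrow>
        \<exists>c. \<forall>x. E x a \<longrightarrow> (\<exists>!y. E y x \<and> E y c)"


section \<open>Rank potentialism\<close>

definition is_trans :: "('a \<Rightarrow> 'a \<Rightarrow> bool) \<Rightarrow> 'a \<Rightarrow> bool" where
  "is_trans E a \<longleftrightarrow> (\<forall>x y. E x y \<and> E y a \<longrightarrow> E x a)"

definition is_Ord :: "('a \<Rightarrow> 'a \<Rightarrow> bool) \<Rightarrow> 'a \<Rightarrow> bool" where
  "is_Ord E \<beta> \<longleftrightarrow> is_trans E \<beta> \<and> (\<forall>x. E x \<beta> \<longrightarrow> is_trans E x)"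

definition is_upair :: "('a \<Rightarrow> 'a \<Rightarrow> bool) \<Rightarrow> 'a \<Rightarrow> 'a \<Rightarrow> 'a \<Rightarrow> bool" where
  "is_upair E a b p \<longleftrightarrow> (\<forall>x. E x p \<longleftrightarrow> x = a \<or> x = b)"

definition is_opair :: "('a \<Rightarrow> 'a \<Rightarrow> bool) \<Rightarrow> 'a \<Rightarrow> 'a \<Rightarrow> 'a \<Rightarrow> bool" where
  "is_opair E a b p \<longleftrightarrow> (\<exists>u v. is_upair E a a u \<and> is_upair E a b v \<and> is_upair E u v p)"

definition maps_to :: "('a \<Rightarrow> 'a \<Rightarrow> bool) \<Rightarrow> 'a \<Rightarrow> 'a \<Rightarrow> 'a \<Rightarrow> bool" where
  "maps_to E f x y \<longleftrightarrow> (\<exists>p. E p f \<and> is_opair E x y p)"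

text \<open>\<open>f\<close> is, inside the model, the sequence of all \<open>V\<^sub>\<alpha>\<close> with \<open>\<alpha> \<le> \<beta>\<close>, where
  \<open>V\<^sub>\<alpha>\<close> is the union of the power sets of the \<open>V\<^sub>\<gamma>\<close> with \<open>\<gamma> < \<alpha>\<close>. The recursion has to
  be witnessed by an element of the model, as the model may be ill-founded.\<close>

definition rank_seq :: "('a \<Rightarrow> 'a \<Rightarrow> bool) \<Rightarrow> 'a \<Rightarrow> 'a \<Rightarrow> bool" where
  "rank_seq E \<beta> f \<longleftrightarrow>
    (\<forall>\<alpha>. E \<alpha> \<beta> \<or> \<alpha> = \<beta> \<longrightarrow>
      (\<exists>!v. maps_to E f \<alpha> v) \<and>
      (\<forall>v. maps_to E f \<alpha> v \<longrightarrow>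
        (\<forall>x. E x v \<longleftrightarrow> (\<exists>\<gamma> w. E \<gamma> \<alpha> \<and> maps_to E f \<gamma> w \<and> (\<forall>y. E y x \<longrightarrow> E y w)))))"

definition Vseg :: "('a \<Rightarrow> 'a \<Rightarrow> bool) \<Rightarrow> 'a \<Rightarrow> 'a set" where
  "Vseg E \<beta> = {x. \<exists>f v. rank_seq E \<beta> f \<and> maps_to E f \<beta> v \<and> E x v}"

text \<open>The world \<open>V\<^sub>\<beta>\<close> is represented by its index, the ordinal \<open>\<beta>\<close> of the model.\<close>

definition ord_le :: "('a \<Rightarrow> 'a \<Rightarrow> bool) \<Rightarrow> 'a \<Rightarrow> 'a \<Rightarrow> bool" where
  "ord_le E \<beta> \<delta> \<longleftrightarrow> is_Ord E \<beta> \<and> is_Ord E \<delta> \<and> (E \<beta> \<delta> \<or> \<beta> = \<delta>)"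

abbreviation Val_rank :: "('a \<Rightarrow> 'a \<Rightarrow> bool) \<Rightarrow> 'a \<Rightarrow> 'a fml set \<Rightarrow> pmf set" where
  "Val_rank E \<equiv> Val E (Vseg E) (ord_le E)"

end

theory Submission
  imports Defs
begin

text \<open>
  Soundness holds because the ordinals of the model are linearly ordered. For the converse take
  \<open>\<beta> = 0\<close>. A formula outside S4.3 fails at the root of a finite chain of clusters, which may be
  taken to be \<open>{0..n} \<times> {0..N}\<close> preordered by the first coordinate. Every ordinal \<open>\<delta>\<close> is sent to
  the pair consisting of the number of limits of limits \<open>\<le> \<delta>\<close>, capped at \<open>n\<close>, and of the largest
  \<open>j \<le> N\<close> such that \<open>\<delta> = \<gamma> + j\<close> for some \<open>\<gamma>\<close>. Since limits are cofinal below each limit of limits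
  and limits of limits are cofinal in the ordinals, this is a bounded morphism. Both coordinates are
  read off in \<open>V\<^sub>\<delta>\<close> by parameter-free first-order sentences, since the ordinals of \<open>V\<^sub>\<delta>\<close> are the
  elements of \<open>\<delta>\<close>. The model may be ill-founded, so all recursions and inductions on its ordinals
  go through definable predicates.
\<close>

section \<open>Kripke semantics\<close>

primrec holds :: "('w \<Rightarrow> 'w \<Rightarrow> bool) \<Rightarrow> ('w \<Rightarrow> nat \<Rightarrow> bool) \<Rightarrow> 'w \<Rightarrow> pmf \<Rightarrow> bool" where
  "holds R V w (PVar n) = V w n"
| "holds R V w PBot = False"
| "holds R V w (PImp p q) = (holds R V w p \<longrightarrow> holds R V w q)"
| "holds R V w (PBox p) = (\<forall>v. R w v \<longrightarrow> holds R V v p)"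

lemma sat_inst: "sat E D R w s (inst \<sigma> p) = holds R (\<lambda>v n. sat E D R v s (\<sigma> n)) w p"
  by (induction p arbitrary: w) auto

definition bounded_morphism_on ::
  "'w set \<Rightarrow> ('w \<Rightarrow> 'w \<Rightarrow> bool) \<Rightarrow> ('v \<Rightarrow> 'v \<Rightarrow> bool) \<Rightarrow> ('w \<Rightarrow> 'v) \<Rightarrow> bool" where
  "bounded_morphism_on A R R' g \<longleftrightarrow>
    (\<forall>w\<in>A. \<forall>v. R w v \<longrightarrow> v \<in> A \<and> R' (g w) (g v)) \<and>
    (\<forall>w\<in>A. \<forall>u. R' (g w) u \<longrightarrow> (\<exists>v. R w v \<and> g v = u))"

lemma holds_bounded_morphism:
  assumes "bounded_morphism_on A R R' g" "w \<in> A"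
    and "\<And>w n. w \<in> A \<Longrightarrow> V w n = V' (g w) n"
  shows "holds R V w p = holds R' V' (g w) p"
  using assms(2)
proof (induction p arbitrary: w)
  case (PBox p)
  have "holds R V v p = holds R' V' (g v) p" "R' (g w) (g v)" if "R w v" for v
    using PBox assms(1) that unfolding bounded_morphism_on_def by blast+
  moreover have "\<exists>v. R w v \<and> g v = u" if "R' (g w) u" for u
    using PBox.prems assms(1) that unfolding bounded_morphism_on_def by blast
  ultimately show ?case by (metis holds.simps(4))
qed (use assms(3) in auto)

lemma S43_sound:
  assumes "p \<in> S43" "w \<in> A"
    and closed: "\<And>w v. w \<in> A \<Longrightarrow> R w v \<Longrightarrow> v \<in> A"
    and refl: "reflp_on A R"
    and trans: "transp_on A R"
    and connected: "\<And>w u v. w \<in> A \<Longrightarrow> R w u \<Longrightarrow> R w v \<Longrightarrow> R u v \<or> R v u"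
  shows "holds R V w p"
  using assms(1,2)
proof (induction arbitrary: w)
  case (ax_3 p q)
  show ?case using connected[OF ax_3] by simp blast
next
  case (ax_T p)
  then show ?case using refl by (simp add: reflp_onD)
next
  case (ax_4 p)
  have "R w u" if "R w v" "R v u" for u v
    using transp_onD[OF trans, of w v u] closed ax_4 that by blast
  then show ?case by auto
next
  case (Nec p)
  then show ?case using closed by auto
qed auto

section \<open>The canonical model of S4.3\<close>

inductive derives :: "pmf set \<Rightarrow> pmf \<Rightarrow> bool" (infix \<open>\<turnstile>\<close> 50) for \<Gamma> where
  axiom: "p \<in> S43 \<Longrightarrow> \<Gamma> \<turnstile> p"
| premise: "p \<in> \<Gamma> \<Longrightarrow> \<Gamma> \<turnstile> p"
| mp: "\<Gamma> \<turnstile> PImp p q \<Longrightarrow> \<Gamma> \<turnstile> p \<Longrightarrow> \<Gamma> \<turnstile> q"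

lemma derives_weaken: "\<Gamma> \<turnstile> q \<Longrightarrow> \<Gamma> \<turnstile> PImp p q"
  by (meson derives.mp derives.axiom S43.prop_K)

lemma derives_imp_distrib: "\<Gamma> \<turnstile> PImp p (PImp q r) \<Longrightarrow> \<Gamma> \<turnstile> PImp p q \<Longrightarrow> \<Gamma> \<turnstile> PImp p r"
  by (meson derives.mp derives.axiom S43.prop_S)

lemma derives_imp_refl: "\<Gamma> \<turnstile> PImp p p"
  by (meson derives_imp_distrib derives.axiom S43.prop_K)

lemma deduction_theorem: "insert p \<Gamma> \<turnstile> q \<Longrightarrow> \<Gamma> \<turnstile> PImp p q"
proof (induction rule: derives.induct)
  case (premise q)
  then show ?case using derives_imp_refl derives_weaken derives.premise by auto
qed (auto intro: derives_weaken derives.axiom derives_imp_distrib)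

lemma derives_mono: "\<Gamma> \<turnstile> q \<Longrightarrow> \<Gamma> \<subseteq> \<Delta> \<Longrightarrow> \<Delta> \<turnstile> q"
  by (induction rule: derives.induct) (auto intro: derives.intros)

lemma derives_PBox: "{p. PBox p \<in> \<Gamma>} \<turnstile> q \<Longrightarrow> \<Gamma> \<turnstile> PBox q"
proof (induction rule: derives.induct)
  case (mp p q)
  then show ?case by (meson derives.mp derives.axiom S43.ax_K)
qed (auto intro: derives.intros S43.Nec)

lemma empty_derives_iff: "{} \<turnstile> q \<longleftrightarrow> q \<in> S43"
proof
  show "q \<in> S43" if "{} \<turnstile> q"
    using that by (induction rule: derives.induct) (auto intro: S43.MP)
qed (rule derives.axiom)

lemma derives_Union_chain:
  assumes "\<Union>\<C> \<turnstile> q" "\<C> \<noteq> {}" and chain: "\<And>\<Gamma> \<Delta>. \<Gamma> \<in> \<C> \<Longrightarrow> \<Delta> \<in> \<C> \<Longrightarrow> \<Gamma> \<subseteq> \<Delta> \<or> \<Delta> \<subseteq> \<Gamma>"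
  shows "\<exists>\<Gamma>\<in>\<C>. \<Gamma> \<turnstile> q"
  using assms(1)
proof (induction rule: derives.induct)
  case (mp p q)
  then show ?case by (meson chain derives.mp derives_mono)
qed (use assms(2) in \<open>auto intro: derives.intros\<close>)

definition consistent :: "pmf set \<Rightarrow> bool" where
  "consistent \<Gamma> \<longleftrightarrow> \<not> \<Gamma> \<turnstile> PBot"

definition maximal_consistent :: "pmf set \<Rightarrow> bool" where
  "maximal_consistent x \<longleftrightarrow> consistent x \<and> (\<forall>p. p \<notin> x \<longrightarrow> \<not> consistent (insert p x))"

lemma consistent_insert_PNeg: "\<not> \<Gamma> \<turnstile> q \<Longrightarrow> consistent (insert (PNeg q) \<Gamma>)"
  unfolding consistent_def by (meson derives.mp derives.axiom deduction_theorem S43.prop_DN)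

lemma maximal_consistent_extension:
  assumes "consistent \<Gamma>"
  obtains x where "maximal_consistent x" "\<Gamma> \<subseteq> x"
proof -
  let ?A = "{x. consistent x \<and> \<Gamma> \<subseteq> x}"
  have "\<exists>x\<in>?A. \<forall>y\<in>?A. x \<subseteq> y \<longrightarrow> y = x"
  proof (rule subset_Zorn_nonempty)
    fix \<C> assume ne: "\<C> \<noteq> {}" and "subset.chain ?A \<C>"
    then have sub: "\<C> \<subseteq> ?A" and chain: "\<And>x y. x \<in> \<C> \<Longrightarrow> y \<in> \<C> \<Longrightarrow> x \<subseteq> y \<or> y \<subseteq> x"
      unfolding subset.chain_def by blast+
    have "consistent (\<Union>\<C>)"
      using derives_Union_chain[OF _ ne chain] sub unfolding consistent_def by blast
    then show "\<Union>\<C> \<in> ?A" using ne sub by blast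
  qed (use assms in blast)
  then obtain x where x: "consistent x" "\<Gamma> \<subseteq> x"
    and maximal: "\<And>y. consistent y \<Longrightarrow> x \<subseteq> y \<Longrightarrow> y = x" by (smt (verit) mem_Collect_eq subset_trans)
  have "\<not> consistent (insert p x)" if "p \<notin> x" for p
    using maximal[of "insert p x"] that by blast
  then have "maximal_consistent x" using x(1) by (simp add: maximal_consistent_def)
  then show ?thesis using that x(2) by blast
qed

context
  fixes x assumes x: "maximal_consistent x"
begin

lemma derives_iff_mem_maximal_consistent: "x \<turnstile> p \<longleftrightarrow> p \<in> x"
  using x unfolding maximal_consistent_def consistent_def
  by (meson derives.premise derives.mp deduction_theorem)

lemma S43_in_maximal_consistent: "p \<in> S43 \<Longrightarrow> p \<in> x"
  using derives_iff_mem_maximal_consistent derives.axiom by blast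

lemma PBot_notin_maximal_consistent: "PBot \<notin> x"
  using x derives_iff_mem_maximal_consistent
  by (auto simp: maximal_consistent_def consistent_def)

lemma PImp_in_maximal_consistent_iff: "PImp p q \<in> x \<longleftrightarrow> (p \<in> x \<longrightarrow> q \<in> x)"
proof
  assume imp: "p \<in> x \<longrightarrow> q \<in> x"
  have "PImp p q \<in> x" if "p \<notin> x"
  proof -
    have "insert p x \<turnstile> PBot"
      using x that by (simp add: maximal_consistent_def consistent_def)
    then have "insert p x \<turnstile> q"
      by (meson derives_weaken derives.mp derives.axiom S43.prop_DN)
    then show ?thesis
      using derives_iff_mem_maximal_consistent deduction_theorem by blast
  qed
  then show "PImp p q \<in> x"
    using imp derives_iff_mem_maximal_consistent derives_weaken by blast
qed (use derives_iff_mem_maximal_consistent derives.mp in blast)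

lemma maximal_consistent_T: "PBox p \<in> x \<Longrightarrow> p \<in> x"
  using S43_in_maximal_consistent[OF S43.ax_T] PImp_in_maximal_consistent_iff by blast

lemma maximal_consistent_4: "PBox p \<in> x \<Longrightarrow> PBox (PBox p) \<in> x"
  using S43_in_maximal_consistent[OF S43.ax_4] PImp_in_maximal_consistent_iff by blast

end

lemmas maximal_consistent_simps = PImp_in_maximal_consistent_iff PBot_notin_maximal_consistent

lemma lindenbaum:
  assumes "\<not> \<Gamma> \<turnstile> q"
  obtains x where "maximal_consistent x" "\<Gamma> \<subseteq> x" "q \<notin> x"
proof -
  obtain x where x: "maximal_consistent x" "insert (PNeg q) \<Gamma> \<subseteq> x"
    using maximal_consistent_extension consistent_insert_PNeg assms by blast
  then have "q \<notin> x" using maximal_consistent_simps by blast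
  then show ?thesis using that x by blast
qed

definition canonical_le :: "pmf set \<Rightarrow> pmf set \<Rightarrow> bool" (infix \<open>\<preceq>\<close> 50) where
  "x \<preceq> y \<longleftrightarrow> (\<forall>p. PBox p \<in> x \<longrightarrow> p \<in> y)"

lemma canonical_le_refl: "maximal_consistent x \<Longrightarrow> x \<preceq> x"
  by (simp add: canonical_le_def maximal_consistent_T)

lemma canonical_le_PBox: "maximal_consistent x \<Longrightarrow> x \<preceq> y \<Longrightarrow> PBox p \<in> x \<Longrightarrow> PBox p \<in> y"
  using maximal_consistent_4 by (simp add: canonical_le_def)

lemma canonical_le_trans: "maximal_consistent x \<Longrightarrow> x \<preceq> y \<Longrightarrow> y \<preceq> z \<Longrightarrow> x \<preceq> z"
  using canonical_le_PBox unfolding canonical_le_def by blast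

lemma PBox_in_maximal_consistent_iff:
  assumes "maximal_consistent x"
  shows "PBox p \<in> x \<longleftrightarrow> (\<forall>y. maximal_consistent y \<and> x \<preceq> y \<longrightarrow> p \<in> y)"
proof
  assume all: "\<forall>y. maximal_consistent y \<and> x \<preceq> y \<longrightarrow> p \<in> y"
  have "{q. PBox q \<in> x} \<turnstile> p"
  proof (rule ccontr)
    assume "\<not> {q. PBox q \<in> x} \<turnstile> p"
    then obtain y where "maximal_consistent y" "{q. PBox q \<in> x} \<subseteq> y" "p \<notin> y"
      by (rule lindenbaum)
    then show False using all by (auto simp: canonical_le_def)
  qed
  then show "PBox p \<in> x"
    using derives_PBox derives_iff_mem_maximal_consistent[OF assms] by blast
qed (simp add: canonical_le_def)

lemma PDia_in_maximal_consistent_iff: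
  assumes "maximal_consistent x"
  shows "PDia p \<in> x \<longleftrightarrow> (\<exists>y. maximal_consistent y \<and> x \<preceq> y \<and> p \<in> y)"
  using PBox_in_maximal_consistent_iff[OF assms, of "PNeg p"] assms
  by (auto simp: maximal_consistent_simps)

lemma canonical_le_connected:
  assumes x: "maximal_consistent x" and y: "maximal_consistent y" and z: "maximal_consistent z"
    and "x \<preceq> y" "x \<preceq> z"
  shows "y \<preceq> z \<or> z \<preceq> y"
proof (rule ccontr)
  assume "\<not> ?thesis"
  then obtain a b where ab: "PBox a \<in> y" "a \<notin> z" "PBox b \<in> z" "b \<notin> y"
    by (auto simp: canonical_le_def)
  let ?p = "PAnd (PBox a) (PNeg b)" and ?q = "PAnd (PBox b) (PNeg a)"
  let ?r = "POr (PAnd ?p (PDia ?q)) (PAnd ?q (PDia ?p))"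
  have exclusive: "\<not> (PBox c \<in> u \<and> PDia (PAnd d (PNeg c)) \<in> u)" if "maximal_consistent u" for u c d
    using that unfolding PDia_in_maximal_consistent_iff[OF that]
    by (auto simp: maximal_consistent_simps canonical_le_def)
  have "?p \<in> y" "?q \<in> z" using ab y z by (simp_all add: maximal_consistent_simps)
  then have "PDia ?p \<in> x" "PDia ?q \<in> x"
    using assms unfolding PDia_in_maximal_consistent_iff[OF x] by blast+
  then have "PDia ?r \<in> x"
    using S43_in_maximal_consistent[OF x S43.ax_3[of ?p ?q]] x
    by (simp add: maximal_consistent_simps)
  then obtain u where u: "maximal_consistent u" "?r \<in> u"
    using PDia_in_maximal_consistent_iff[OF x] by blast
  then have "PBox a \<in> u \<and> PDia ?q \<in> u \<or> PBox b \<in> u \<and> PDia ?p \<in> u"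
    by (auto simp: maximal_consistent_simps)
  then show False using exclusive[OF u(1)] by blast
qed

section \<open>Finite models of S4.3\<close>

definition cluster_chain :: "'w set \<Rightarrow> ('w \<Rightarrow> nat) \<Rightarrow> 'w \<Rightarrow> 'w \<Rightarrow> bool" where
  "cluster_chain W r w v \<longleftrightarrow> v \<in> W \<and> r w \<le> r v"

primrec subformulas :: "pmf \<Rightarrow> pmf set" where
  "subformulas (PVar n) = {PVar n}"
| "subformulas PBot = {PBot}"
| "subformulas (PImp p q) = insert (PImp p q) (subformulas p \<union> subformulas q)"
| "subformulas (PBox p) = insert (PBox p) (subformulas p)"

lemma finite_subformulas: "finite (subformulas p)"
  by (induction p) auto

lemma subformulas_refl: "p \<in> subformulas p"
  by (cases p) auto

lemma subformulas_trans: "q \<in> subformulas p \<Longrightarrow> r \<in> subformulas q \<Longrightarrow> r \<in> subformulas p"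
  by (induction p) auto

lemma subformulas_PImp:
  "PImp q r \<in> subformulas p \<Longrightarrow> q \<in> subformulas p \<and> r \<in> subformulas p"
  using subformulas_trans[of "PImp q r" p] subformulas_refl by simp

lemma subformulas_PBox: "PBox q \<in> subformulas p \<Longrightarrow> q \<in> subformulas p"
  using subformulas_trans[of "PBox q" p] subformulas_refl by simp

definition filtration :: "pmf set \<Rightarrow> pmf \<Rightarrow> pmf set set" where
  "filtration x p = (\<lambda>y. y \<inter> subformulas p) ` {y. maximal_consistent y \<and> x \<preceq> y}"

definition box_count :: "pmf set \<Rightarrow> nat" where
  "box_count T = card {q. PBox q \<in> T}"

lemma finite_filtration: "finite (filtration x p)"
  by (rule finite_subset[of _ "Pow (subformulas p)"]) (auto simp: filtration_def finite_subformulas)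

text \<open>The sets of boxed formulas of the worlds of the filtration form a chain under inclusion, on
  which cardinality is an order embedding.\<close>

lemma box_count_le_iff:
  assumes x: "maximal_consistent x"
    and y: "maximal_consistent y" "x \<preceq> y" and z: "maximal_consistent z" "x \<preceq> z"
  shows "box_count (y \<inter> subformulas p) \<le> box_count (z \<inter> subformulas p) \<longleftrightarrow>
    (\<forall>q. PBox q \<in> y \<inter> subformulas p \<longrightarrow> PBox q \<in> z)"
proof -
  define boxes where "boxes u = {q. PBox q \<in> u \<inter> subformulas p}" for u
  have "boxes y \<subseteq> boxes z \<or> boxes z \<subseteq> boxes y"
    using canonical_le_connected[OF x y(1) z(1) y(2) z(2)] canonical_le_PBox y z
    unfolding boxes_def by blast
  moreover have "finite (boxes u)" for u
  proof (rule finite_subset)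
    show "finite (PBox -` subformulas p)"
      by (rule finite_vimageI) (auto simp: finite_subformulas inj_def)
  qed (auto simp: boxes_def)
  ultimately have "card (boxes y) \<le> card (boxes z) \<longleftrightarrow> boxes y \<subseteq> boxes z"
    by (metis card_mono card_seteq order_refl)
  then show ?thesis by (auto simp: box_count_def boxes_def)
qed

lemma holds_filtration:
  assumes x: "maximal_consistent x"
    and "q \<in> subformulas p" "maximal_consistent y" "x \<preceq> y"
  shows "holds (cluster_chain (filtration x p) box_count) (\<lambda>T n. PVar n \<in> T) (y \<inter> subformulas p) q
    \<longleftrightarrow> q \<in> y"
  using assms(2-)
proof (induction q arbitrary: y)
  case (PImp q r)
  then show ?case
    using subformulas_PImp[OF PImp.prems(1)] by (simp add: PImp_in_maximal_consistent_iff)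
next
  case (PBox q)
  let ?R = "cluster_chain (filtration x p) box_count" and ?tr = "\<lambda>y. y \<inter> subformulas p"
  have IH: "holds ?R (\<lambda>T n. PVar n \<in> T) (?tr z) q \<longleftrightarrow> q \<in> z"
    if "maximal_consistent z" "x \<preceq> z" for z
    using PBox.IH[OF subformulas_PBox[OF PBox.prems(1)] that] .
  have R_iff: "?R (?tr y) (?tr z) \<longleftrightarrow> (\<forall>r. PBox r \<in> ?tr y \<longrightarrow> PBox r \<in> z)"
    if "maximal_consistent z" "x \<preceq> z" for z
    using box_count_le_iff[OF x PBox.prems(2,3) that] that
    by (auto simp: cluster_chain_def filtration_def)
  show ?case
  proof
    assume all: "holds ?R (\<lambda>T n. PVar n \<in> T) (?tr y) (PBox q)"
    have "q \<in> z" if z: "maximal_consistent z" "y \<preceq> z" for z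
    proof -
      have xz: "x \<preceq> z" using canonical_le_trans x PBox.prems(3) z(2) .
      have "?R (?tr y) (?tr z)"
        using R_iff[OF z(1) xz] canonical_le_PBox[OF PBox.prems(2) z(2)] by blast
      then show ?thesis using all IH[OF z(1) xz] by simp
    qed
    then show "PBox q \<in> y" using PBox_in_maximal_consistent_iff[OF PBox.prems(2)] by blast
  next
    assume "PBox q \<in> y"
    then have "q \<in> z" if "maximal_consistent z" "x \<preceq> z" "?R (?tr y) (?tr z)" for z
      using R_iff that PBox.prems(1) maximal_consistent_T by blast
    then show "holds ?R (\<lambda>T n. PVar n \<in> T) (?tr y) (PBox q)"
      using IH by (auto simp: cluster_chain_def filtration_def)
  qed
qed (auto simp: PBot_notin_maximal_consistent)

lemma S43_finite_model_property:
  assumes "p \<notin> S43"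
  obtains W :: "pmf set set" and w r V where
    "finite W" "w \<in> W" "\<And>v. v \<in> W \<Longrightarrow> r w \<le> r v" "\<not> holds (cluster_chain W r) V w p"
proof -
  obtain x where x: "maximal_consistent x" "p \<notin> x"
    using lindenbaum[of "{}" p] assms empty_derives_iff by blast
  note refl = canonical_le_refl[OF x(1)]
  show ?thesis
  proof (rule that[OF finite_filtration])
    show "x \<inter> subformulas p \<in> filtration x p" using x(1) refl by (auto simp: filtration_def)
    show "box_count (x \<inter> subformulas p) \<le> box_count T" if "T \<in> filtration x p" for T
      using that box_count_le_iff[OF x(1) x(1) refl] canonical_le_PBox[OF x(1)]
      by (auto simp: filtration_def)
    show "\<not> holds (cluster_chain (filtration x p) box_count) (\<lambda>T n. PVar n \<in> T)
        (x \<inter> subformulas p) p"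
      using holds_filtration[OF x(1) subformulas_refl x(1) refl] x(2) by simp
  qed
qed

definition floor_in :: "nat set \<Rightarrow> nat \<Rightarrow> nat" where
  "floor_in K m = Max {k \<in> K. k \<le> m}"

lemma floor_in_mem:
  assumes "finite K" "k \<in> K" "k \<le> m"
  shows "floor_in K m \<in> K \<and> floor_in K m \<le> m"
proof -
  have "floor_in K m \<in> {k \<in> K. k \<le> m}"
    unfolding floor_in_def by (rule Max_in) (use assms in auto)
  then show ?thesis by simp
qed

lemma floor_in_ge: "finite K \<Longrightarrow> k \<in> K \<Longrightarrow> k \<le> m \<Longrightarrow> k \<le> floor_in K m"
  unfolding floor_in_def by (intro Max_ge) auto

lemma floor_in_eq: "finite K \<Longrightarrow> m \<in> K \<Longrightarrow> floor_in K m = m"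
  using floor_in_mem[of K m m] floor_in_ge[of K m m] by simp

lemma monotone_enumeration_of_finite:
  assumes "finite K" "k0 \<in> K" and least: "\<And>k. k \<in> K \<Longrightarrow> k0 \<le> k"
  obtains level :: "nat \<Rightarrow> nat" where "mono level" "\<And>i. level i \<in> K" "level 0 = k0"
    "\<And>i k. k \<in> K \<Longrightarrow> level i \<le> k \<Longrightarrow> \<exists>i'\<ge>i. i' \<le> max i k \<and> level i' = k"
proof
  define level where "level i = floor_in K (k0 + i)" for i
  have level_mem: "level i \<in> K" "level i \<le> k0 + i" for i
    using floor_in_mem[OF assms(1,2), of "k0 + i"] by (simp_all add: level_def)
  have level_ge: "k \<le> level i" if "k \<in> K" "k \<le> k0 + i" for k i
    unfolding level_def using floor_in_ge assms(1) that .
  have level_diff: "level (k - k0) = k" if "k \<in> K" for k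
    using floor_in_eq[OF assms(1) that] least[OF that] by (simp add: level_def)
  show "mono level"
  proof (rule monoI)
    show "level i \<le> level i'" if "i \<le> i'" for i i'
      using level_mem[of i] that by (intro level_ge) auto
  qed
  show "level i \<in> K" for i by (rule level_mem)
  show "level 0 = k0" using level_diff[OF assms(2)] by simp
  show "\<exists>i'\<ge>i. i' \<le> max i k \<and> level i' = k" if k: "k \<in> K" "level i \<le> k" for i k
  proof (cases "i \<le> k - k0")
    case True
    then show ?thesis using level_diff[OF k(1)] by (intro exI[of _ "k - k0"]) auto
  next
    case False
    then show ?thesis using k level_ge[OF k(1), of i] by (intro exI[of _ i]) auto
  qed
qed

lemma finite_enumeration_from:
  assumes "finite W" "w \<in> W"
  obtains e :: "nat \<Rightarrow> 'w" and N where "e 0 = w" "e ` {..N} = W"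
proof -
  obtain ws where "set ws = W" using assms(1) finite_list by blast
  then have "(!) (w # ws) ` {..length ws} = W"
    using assms(2) nth_image[of "length (w # ws)" "w # ws"]
    by (simp add: insert_absorb atLeast0LessThan lessThan_Suc_atMost)
  then show ?thesis by (rule that[rotated]) simp
qed

text \<open>Empty levels are filled with copies of the cluster below, and clusters are padded with copies
  of one of their points.\<close>

lemma cluster_chain_image_of_grid:
  fixes r :: "'w \<Rightarrow> nat"
  assumes "finite W" "w \<in> W" "\<And>v. v \<in> W \<Longrightarrow> r w \<le> r v"
  obtains n N g where "g (0::nat, 0::nat) = w"
    "bounded_morphism_on ({..n} \<times> {..N}) (cluster_chain ({..n} \<times> {..N}) fst) (cluster_chain W r) g"
proof -
  obtain e :: "nat \<Rightarrow> 'w" and N where e0: "e 0 = w" and e: "e ` {..N} = W"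
    using assms(1,2) by (rule finite_enumeration_from)
  have W: "finite (r ` W)" "r w \<in> r ` W" "\<And>k. k \<in> r ` W \<Longrightarrow> r w \<le> k"
    using assms by auto
  obtain level where level: "mono level" "\<And>i. level i \<in> r ` W" "level 0 = r w"
    and level_reaches: "\<And>i k. k \<in> r ` W \<Longrightarrow> level i \<le> k \<Longrightarrow> \<exists>i'\<ge>i. i' \<le> max i k \<and> level i' = k"
    using monotone_enumeration_of_finite[OF W] by metis
  define n where "n = Max (r ` W)"
  define g where "g = (\<lambda>(i, j). if r (e j) = level i then e j else SOME v. v \<in> W \<and> r v = level i)"
  have g: "g (i, j) \<in> W \<and> r (g (i, j)) = level i" if "j \<le> N" for i j
  proof -
    have "\<exists>v. v \<in> W \<and> r v = level i" using level(2)[of i] by auto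
    from someI_ex[OF this] show ?thesis using e that by (auto simp: g_def)
  qed
  have onto: "\<exists>i' j'. i \<le> i' \<and> i' \<le> n \<and> j' \<le> N \<and> g (i', j') = u"
    if u: "u \<in> W" "level i \<le> r u" "i \<le> n" for i u
  proof -
    obtain j' where "j' \<le> N" "e j' = u" using e u(1) by auto
    moreover obtain i' where "i \<le> i'" "i' \<le> max i (r u)" "level i' = r u"
      using level_reaches[of "r u" i] u(1,2) by blast
    moreover have "r u \<le> n" unfolding n_def using W(1) u(1) by simp
    ultimately show ?thesis using u(3) by (intro exI[of _ i'] exI[of _ j']) (auto simp: g_def)
  qed
  show ?thesis
  proof (rule that[of g n N])
    show "g (0, 0) = w" by (simp add: g_def e0 level(3))
    show "bounded_morphism_on ({..n} \<times> {..N}) (cluster_chain ({..n} \<times> {..N}) fst)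
        (cluster_chain W r) g"
      using g onto monoD[OF level(1)]
      by (auto simp: bounded_morphism_on_def cluster_chain_def) blast
  qed
qed

lemma S43_grid_countermodel:
  assumes "p \<notin> S43"
  obtains n N V where "\<not> holds (cluster_chain ({..n} \<times> {..N}) fst) V (0::nat, 0::nat) p"
proof -
  obtain W :: "pmf set set" and w r V where W: "finite W" "w \<in> W" "\<And>v. v \<in> W \<Longrightarrow> r w \<le> r v"
    and countermodel: "\<not> holds (cluster_chain W r) V w p"
    using S43_finite_model_property[OF assms] by metis
  obtain n N g where g: "g (0::nat, 0::nat) = w"
    "bounded_morphism_on ({..n} \<times> {..N}) (cluster_chain ({..n} \<times> {..N}) fst) (cluster_chain W r) g"
    using cluster_chain_image_of_grid[of W w r, OF W] by metis
  have "holds (cluster_chain ({..n} \<times> {..N}) fst) (\<lambda>v. V (g v)) (0, 0) p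
      = holds (cluster_chain W r) V w p"
    using holds_bounded_morphism[OF g(2), of "(0, 0)" "\<lambda>v. V (g v)" V p] g(1) by simp
  then show ?thesis using that countermodel by blast
qed

section \<open>Definability\<close>

lemma sat_cong:
  "(\<And>n. n \<in> fvars \<phi> \<Longrightarrow> s n = s' n) \<Longrightarrow> sat E D R w s \<phi> = sat E D R w s' \<phi>"
proof (induction \<phi> arbitrary: s s' w)
  case (Mem t u)
  then show ?case by (cases t; cases u) auto
next
  case (Eql t u)
  then show ?case by (cases t; cases u) auto
next
  case (Imp \<phi> \<psi>)
  have "sat E D R w s \<phi> = sat E D R w s' \<phi>" "sat E D R w s \<psi> = sat E D R w s' \<psi>"
    using Imp.prems by (intro Imp.IH; simp)+
  then show ?case by simp
next
  case (Forall n \<phi>)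
  have "sat E D R w (s(n := x)) \<phi> = sat E D R w (s'(n := x)) \<phi>" for x
    using Forall.prems by (intro Forall.IH) simp
  then show ?case by simp
next
  case (Box \<phi>)
  have "sat E D R v s \<phi> = sat E D R v s' \<phi>" for v
    using Box.prems by (intro Box.IH) simp
  then show ?case by simp
qed simp

lemma finite_tvars: "finite (tvars t)"
  by (cases t) auto

lemma finite_fvars: "finite (fvars \<phi>)"
  by (induction \<phi>) (auto simp: finite_tvars)

lemma finite_params: "finite (params \<phi>)"
proof -
  have "finite (tparams t)" for t :: "'a trm" by (cases t) auto
  then show ?thesis by (induction \<phi>) auto
qed

definition free_terms :: "'a fml \<Rightarrow> 'a trm set" where
  "free_terms \<phi> = Var ` fvars \<phi> \<union> Par ` params \<phi>"

lemma finite_free_terms: "finite (free_terms \<phi>)"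
  by (simp add: free_terms_def finite_fvars finite_params)

definition fresh :: "nat set \<Rightarrow> nat" where
  "fresh S = (LEAST n. n \<notin> S)"

lemma fresh_notin: "finite S \<Longrightarrow> fresh S \<notin> S"
  unfolding fresh_def by (rule LeastI_ex) (rule ex_new_if_finite[OF infinite_UNIV_nat])

text \<open>Parameters are substituted as well, so that they can be traded for variables.\<close>

primrec subst :: "'a fml \<Rightarrow> ('a trm \<Rightarrow> 'a trm) \<Rightarrow> 'a fml" where
  "subst (Mem t u) \<tau> = Mem (\<tau> t) (\<tau> u)"
| "subst (Eql t u) \<tau> = Eql (\<tau> t) (\<tau> u)"
| "subst Bot \<tau> = Bot"
| "subst (Imp \<phi> \<psi>) \<tau> = Imp (subst \<phi> \<tau>) (subst \<psi> \<tau>)"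
| "subst (Forall n \<phi>) \<tau> =
    (let m = fresh (Var -` \<tau> ` free_terms (Forall n \<phi>))
     in Forall m (subst \<phi> (\<tau>(Var n := Var m))))"
| "subst (Box \<phi>) \<tau> = Box (subst \<phi> \<tau>)"

lemma nonmodal_subst: "nonmodal (subst \<phi> \<tau>) = nonmodal \<phi>"
  by (induction \<phi> arbitrary: \<tau>) (auto simp: Let_def)

lemma free_terms_Mem: "free_terms (Mem t u) = {t, u}"
  by (cases t; cases u) (auto simp: free_terms_def)

lemma free_terms_Eql: "free_terms (Eql t u) = {t, u}"
  by (cases t; cases u) (auto simp: free_terms_def)

lemma free_terms_Imp: "free_terms (Imp \<phi> \<psi>) = free_terms \<phi> \<union> free_terms \<psi>"
  by (auto simp: free_terms_def)

lemma free_terms_Forall: "free_terms (Forall n \<phi>) = free_terms \<phi> - {Var n}"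
  by (auto simp: free_terms_def)

lemma free_terms_Box: "free_terms (Box \<phi>) = free_terms \<phi>"
  by (simp add: free_terms_def)

lemmas free_terms_simps =
  free_terms_Mem free_terms_Eql free_terms_Imp free_terms_Forall free_terms_Box

lemma free_terms_subst: "free_terms (subst \<phi> \<tau>) \<subseteq> \<tau> ` free_terms \<phi>"
proof (induction \<phi> arbitrary: \<tau>)
  case Bot
  then show ?case by (simp add: free_terms_def)
next
  case (Imp \<phi> \<psi>)
  show ?case using Imp.IH[of \<tau>] by (simp add: free_terms_simps image_Un le_supI1 le_supI2)
next
  case (Forall n \<phi>)
  define m where "m = fresh (Var -` \<tau> ` free_terms (Forall n \<phi>))"
  have "free_terms (subst (Forall n \<phi>) \<tau>) = free_terms (subst \<phi> (\<tau>(Var n := Var m))) - {Var m}"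
    by (simp add: Let_def m_def free_terms_Forall[of "fresh _"])
  also have "\<dots> \<subseteq> (\<tau>(Var n := Var m)) ` free_terms \<phi> - {Var m}"
    by (rule Diff_mono[OF Forall.IH order_refl])
  also have "\<dots> \<subseteq> \<tau> ` free_terms (Forall n \<phi>)"
    by (auto simp: free_terms_Forall split: if_splits)
  finally show ?case .
qed (simp_all add: free_terms_simps)

lemma
  assumes "\<And>t. t \<in> free_terms \<phi> \<Longrightarrow> tparams (\<tau> t) \<subseteq> A \<and> tvars (\<tau> t) \<subseteq> S"
  shows params_subst_subset: "params (subst \<phi> \<tau>) \<subseteq> A"
    and fvars_subst_subset: "fvars (subst \<phi> \<tau>) \<subseteq> S"
proof -
  have free: "tparams u \<subseteq> A \<and> tvars u \<subseteq> S" if "u \<in> free_terms (subst \<phi> \<tau>)" for u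
    using that assms free_terms_subst[of \<phi> \<tau>] by blast
  show "params (subst \<phi> \<tau>) \<subseteq> A" using free[of "Par _"] by (auto simp: free_terms_def)
  show "fvars (subst \<phi> \<tau>) \<subseteq> S" using free[of "Var _"] by (auto simp: free_terms_def)
qed

lemma sat_subst:
  assumes "\<And>a. a \<in> params \<phi> \<Longrightarrow> tval s (\<tau> (Par a)) = a"
  shows "sat E D R w s (subst \<phi> \<tau>) = sat E D R w (\<lambda>n. tval s (\<tau> (Var n))) \<phi>"
  using assms
proof (induction \<phi> arbitrary: s \<tau> w)
  case (Mem t u)
  then show ?case by (cases t; cases u) auto
next
  case (Eql t u)
  then show ?case by (cases t; cases u) auto
next
  case (Forall n \<phi>)
  define m where "m = fresh (Var -` \<tau> ` free_terms (Forall n \<phi>))"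
  have fresh: "m \<notin> Var -` \<tau> ` free_terms (Forall n \<phi>)"
    unfolding m_def by (rule fresh_notin) (simp add: finite_vimageI finite_free_terms inj_def)
  have update: "tval (s(m := x)) (\<tau> t) = tval s (\<tau> t)" if "t \<in> free_terms (Forall n \<phi>)" for t x
  proof -
    have "\<tau> t \<noteq> Var m" using fresh that by (metis image_eqI vimageI)
    then show ?thesis by (cases "\<tau> t") auto
  qed
  have "sat E D R w (s(m := x)) (subst \<phi> (\<tau>(Var n := Var m)))
      = sat E D R w ((\<lambda>k. tval s (\<tau> (Var k)))(n := x)) \<phi>" for x
  proof -
    have "tval (s(m := x)) ((\<tau>(Var n := Var m)) (Par a)) = a" if "a \<in> params \<phi>" for a
      using Forall.prems[of a] update[of "Par a" x] that by (simp add: free_terms_def)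
    then have "sat E D R w (s(m := x)) (subst \<phi> (\<tau>(Var n := Var m)))
        = sat E D R w (\<lambda>k. tval (s(m := x)) ((\<tau>(Var n := Var m)) (Var k))) \<phi>"
      by (rule Forall.IH)
    also have "\<dots> = sat E D R w ((\<lambda>k. tval s (\<tau> (Var k)))(n := x)) \<phi>"
      using update[of "Var _" x] by (intro sat_cong) (auto simp: free_terms_def)
    finally show ?thesis .
  qed
  then show ?case by (simp add: m_def Let_def)
qed auto

definition term_function :: "'a set \<Rightarrow> nat \<Rightarrow> ((nat \<Rightarrow> 'a) \<Rightarrow> 'a) \<Rightarrow> bool" where
  "term_function A k f \<longleftrightarrow> (\<exists>t. tparams t \<subseteq> A \<and> tvars t \<subseteq> {..<k} \<and> f = (\<lambda>s. tval s t))"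

lemma term_function_Var: "i < k \<Longrightarrow> term_function A k (\<lambda>s. s i)"
  unfolding term_function_def by (rule exI[of _ "Var i"]) simp

lemma term_function_Par: "a \<in> A \<Longrightarrow> term_function A k (\<lambda>s. a)"
  unfolding term_function_def by (rule exI[of _ "Par a"]) simp

text \<open>Variables are de Bruijn indices, so that the closure rules are syntax-directed. Only
  assignments into the world count, which makes bounded quantifiers absolute for transitive
  worlds.\<close>

definition definable_on :: "('a \<Rightarrow> 'a \<Rightarrow> bool) \<Rightarrow> ('w \<Rightarrow> 'a set) \<Rightarrow> 'w set \<Rightarrow> 'a set \<Rightarrow> nat
    \<Rightarrow> ('w \<Rightarrow> (nat \<Rightarrow> 'a) \<Rightarrow> bool) \<Rightarrow> bool" where
  "definable_on E D W A k P \<longleftrightarrow>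
    (\<exists>\<phi>. nonmodal \<phi> \<and> params \<phi> \<subseteq> A \<and> fvars \<phi> \<subseteq> {..<k} \<and>
      (\<forall>R. \<forall>w\<in>W. \<forall>s. (\<forall>i<k. s i \<in> D w) \<longrightarrow> sat E D R w s \<phi> = P w s))"

lemma definable_onI:
  assumes "nonmodal \<phi>" "params \<phi> \<subseteq> A" "fvars \<phi> \<subseteq> {..<k}"
    and "\<And>R w s. w \<in> W \<Longrightarrow> (\<And>i. i < k \<Longrightarrow> s i \<in> D w) \<Longrightarrow> sat E D R w s \<phi> = P w s"
  shows "definable_on E D W A k P"
  unfolding definable_on_def using assms by blast

lemma definable_on_cong:
  "definable_on E D W A k P \<Longrightarrow>
    (\<And>w s. w \<in> W \<Longrightarrow> (\<And>i. i < k \<Longrightarrow> s i \<in> D w) \<Longrightarrow> P w s = Q w s) \<Longrightarrow>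
    definable_on E D W A k Q"
  unfolding definable_on_def by meson

lemma
  assumes "term_function A k f" "term_function A k g"
  shows definable_on_Mem: "definable_on E D W A k (\<lambda>w s. E (f s) (g s))"
    and definable_on_Eql: "definable_on E D W A k (\<lambda>w s. f s = g s)"
proof -
  obtain t u where "tparams t \<subseteq> A" "tvars t \<subseteq> {..<k}" "f = (\<lambda>s. tval s t)"
    "tparams u \<subseteq> A" "tvars u \<subseteq> {..<k}" "g = (\<lambda>s. tval s u)"
    using assms unfolding term_function_def by blast
  then show "definable_on E D W A k (\<lambda>w s. E (f s) (g s))"
    "definable_on E D W A k (\<lambda>w s. f s = g s)"
    by (intro definable_onI[of "Mem t u"] definable_onI[of "Eql t u"]; simp)+
qed

lemma definable_on_False: "definable_on E D W A k (\<lambda>w s. False)"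
  by (rule definable_onI[of Bot]) simp_all

lemma definable_on_imp:
  assumes "definable_on E D W A k P" "definable_on E D W A k Q"
  shows "definable_on E D W A k (\<lambda>w s. P w s \<longrightarrow> Q w s)"
proof -
  obtain \<phi> where \<phi>: "nonmodal \<phi>" "params \<phi> \<subseteq> A" "fvars \<phi> \<subseteq> {..<k}"
    "\<And>R w s. w \<in> W \<Longrightarrow> (\<And>i. i < k \<Longrightarrow> s i \<in> D w) \<Longrightarrow> sat E D R w s \<phi> = P w s"
    using assms(1) unfolding definable_on_def by blast
  obtain \<psi> where \<psi>: "nonmodal \<psi>" "params \<psi> \<subseteq> A" "fvars \<psi> \<subseteq> {..<k}"
    "\<And>R w s. w \<in> W \<Longrightarrow> (\<And>i. i < k \<Longrightarrow> s i \<in> D w) \<Longrightarrow> sat E D R w s \<psi> = Q w s"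
    using assms(2) unfolding definable_on_def by blast
  show ?thesis by (rule definable_onI[of "Imp \<phi> \<psi>"]) (simp_all add: \<phi> \<psi>)
qed

lemma definable_on_depends:
  assumes "definable_on E D W A k P" "w \<in> W" "\<And>i. i < k \<Longrightarrow> s i \<in> D w"
    and eq: "\<And>i. i < k \<Longrightarrow> s i = s' i"
  shows "P w s = P w s'"
proof -
  obtain \<phi> where \<phi>: "fvars \<phi> \<subseteq> {..<k}"
    "\<And>R w s. w \<in> W \<Longrightarrow> (\<And>i. i < k \<Longrightarrow> s i \<in> D w) \<Longrightarrow> sat E D R w s \<phi> = P w s"
    using assms(1) unfolding definable_on_def by blast
  have "P w s = sat E D (\<lambda>_ _. False) w s \<phi>" using \<phi>(2) assms(2,3) by simp
  also have "\<dots> = sat E D (\<lambda>_ _. False) w s' \<phi>" using \<phi>(1) by (intro sat_cong eq) auto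
  also have "\<dots> = P w s'" using \<phi>(2) assms(2,3) eq by simp
  finally show ?thesis .
qed

lemma definable_on_subst:
  assumes "definable_on E D W A k P"
    and f: "\<And>i. i < k \<Longrightarrow> term_function A l (f i)"
    and in_world: "\<And>i w s. i < k \<Longrightarrow> w \<in> W \<Longrightarrow> (\<And>j. j < l \<Longrightarrow> s j \<in> D w) \<Longrightarrow> f i s \<in> D w"
  shows "definable_on E D W A l (\<lambda>w s. P w (\<lambda>i. f i s))"
proof -
  obtain \<phi> where \<phi>: "nonmodal \<phi>" "params \<phi> \<subseteq> A" "fvars \<phi> \<subseteq> {..<k}"
    "\<And>R w s. w \<in> W \<Longrightarrow> (\<And>i. i < k \<Longrightarrow> s i \<in> D w) \<Longrightarrow> sat E D R w s \<phi> = P w s"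
    using assms(1) unfolding definable_on_def by blast
  obtain t where
    t: "\<And>i. i < k \<Longrightarrow> tparams (t i) \<subseteq> A \<and> tvars (t i) \<subseteq> {..<l} \<and> f i = (\<lambda>s. tval s (t i))"
    using f unfolding term_function_def by metis
  define \<tau> where "\<tau> u = (case u of Var i \<Rightarrow> t i | Par a \<Rightarrow> Par a)" for u
  have \<tau>: "tparams (\<tau> u) \<subseteq> A \<and> tvars (\<tau> u) \<subseteq> {..<l}" if "u \<in> free_terms \<phi>" for u
  proof (cases u)
    case (Var i)
    then have "i < k" using that \<phi>(3) by (auto simp: free_terms_def)
    then show ?thesis using t Var by (simp add: \<tau>_def)
  next
    case (Par a)
    then show ?thesis using that \<phi>(2) by (auto simp: free_terms_def \<tau>_def)
  qed
  have sat_subst_\<phi>: "sat E D R w s (subst \<phi> \<tau>) = P w (\<lambda>i. f i s)"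
    if "w \<in> W" "\<And>j. j < l \<Longrightarrow> s j \<in> D w" for R w s
  proof -
    have "sat E D R w s (subst \<phi> \<tau>) = sat E D R w (\<lambda>n. tval s (t n)) \<phi>"
      using sat_subst[of \<phi> s \<tau>] by (simp add: \<tau>_def)
    also have "\<dots> = sat E D R w (\<lambda>i. f i s) \<phi>"
      using \<phi>(3) t by (intro sat_cong) auto
    also have "\<dots> = P w (\<lambda>i. f i s)" by (rule \<phi>(4)) (simp_all add: in_world that)
    finally show ?thesis .
  qed
  show ?thesis
    by (rule definable_onI[OF _ params_subst_subset[OF \<tau>] fvars_subst_subset[OF \<tau>] sat_subst_\<phi>])
      (simp_all add: nonmodal_subst \<phi>(1))
qed

lemma definable_on_all:
  assumes Q: "definable_on E D W A (Suc k) (\<lambda>w s. Q w (s 0) (\<lambda>i. s (Suc i)))"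
  shows "definable_on E D W A k (\<lambda>w s. \<forall>x\<in>D w. Q w x s)"
proof -
  define rotate where "rotate i = (case i of 0 \<Rightarrow> k | Suc i \<Rightarrow> i)" for i
  have rotate: "rotate i < Suc k" if "i < Suc k" for i
    using that by (auto simp: rotate_def split: nat.splits)
  have "definable_on E D W A (Suc k) (\<lambda>w s. Q w (s k) s)"
    using definable_on_subst[OF Q, where f = "\<lambda>i s. s (rotate i)" and l = "Suc k"] rotate
    by (simp add: term_function_Var) (simp add: rotate_def)
  then obtain \<phi> where \<phi>: "nonmodal \<phi>" "params \<phi> \<subseteq> A" "fvars \<phi> \<subseteq> {..<Suc k}"
    "\<And>R w s. w \<in> W \<Longrightarrow> (\<And>i. i < Suc k \<Longrightarrow> s i \<in> D w) \<Longrightarrow> sat E D R w s \<phi> = Q w (s k) s"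
    unfolding definable_on_def by blast
  have sat_\<phi>: "sat E D R w (s(k := x)) \<phi> = Q w x s"
    if w: "w \<in> W" and s: "\<And>i. i < k \<Longrightarrow> s i \<in> D w" and x: "x \<in> D w" for R w s x
  proof -
    have "(s(k := x)) i \<in> D w" if "i < Suc k" for i
      using that s x by (auto simp: less_Suc_eq)
    then have "sat E D R w (s(k := x)) \<phi> = Q w x (s(k := x))"
      using \<phi>(4)[OF w, of "s(k := x)" R] by simp
    also have "\<dots> = Q w x s"
    proof -
      let ?s = "case_nat x s" and ?s' = "case_nat x (s(k := x))"
      have "?s i \<in> D w \<and> ?s i = ?s' i" if "i < Suc k" for i
        using that s x by (cases i) auto
      then have "Q w (?s 0) (\<lambda>i. ?s (Suc i)) = Q w (?s' 0) (\<lambda>i. ?s' (Suc i))"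
        by (intro definable_on_depends[OF Q w]) blast+
      then show ?thesis by (simp add: fun_upd_def)
    qed
    finally show ?thesis .
  qed
  show ?thesis
  proof (rule definable_onI[of "Forall k \<phi>"])
    show "fvars (Forall k \<phi>) \<subseteq> {..<k}" using \<phi>(3) by auto
  qed (simp_all add: \<phi>(1,2) sat_\<phi>)
qed

lemma definable_on_not: "definable_on E D W A k P \<Longrightarrow> definable_on E D W A k (\<lambda>w s. \<not> P w s)"
  using definable_on_imp[OF _ definable_on_False, of E D W A k P] by simp

lemma definable_on_disj:
  "definable_on E D W A k P \<Longrightarrow> definable_on E D W A k Q \<Longrightarrow>
    definable_on E D W A k (\<lambda>w s. P w s \<or> Q w s)"
  using definable_on_imp[OF definable_on_not, of E D W A k P Q] by (rule definable_on_cong) auto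

lemma definable_on_conj:
  "definable_on E D W A k P \<Longrightarrow> definable_on E D W A k Q \<Longrightarrow>
    definable_on E D W A k (\<lambda>w s. P w s \<and> Q w s)"
  using definable_on_not[OF definable_on_imp[OF _ definable_on_not], of E D W A k P Q] by simp

lemma definable_on_iff:
  "definable_on E D W A k P \<Longrightarrow> definable_on E D W A k Q \<Longrightarrow>
    definable_on E D W A k (\<lambda>w s. P w s = Q w s)"
  using definable_on_conj[OF definable_on_imp definable_on_imp, of E D W A k P Q Q P]
  by (rule definable_on_cong) auto

lemma definable_on_ex:
  assumes "definable_on E D W A (Suc k) (\<lambda>w s. Q w (s 0) (\<lambda>i. s (Suc i)))"
  shows "definable_on E D W A k (\<lambda>w s. \<exists>x\<in>D w. Q w x s)"
  using definable_on_not[OF definable_on_all[where Q = "\<lambda>w x s. \<not> Q w x s",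
      OF definable_on_not[OF assms]]]
  by simp

lemma definable_on_const: "definable_on E D W A k (\<lambda>w s. c)"
  using definable_on_False[of E D W A k] definable_on_not[OF definable_on_False, of E D W A k]
  by (cases c) simp_all

lemma definable_on_finite_ex:
  assumes "finite I" "\<And>i. i \<in> I \<Longrightarrow> definable_on E D W A k (P i)"
  shows "definable_on E D W A k (\<lambda>w s. \<exists>i\<in>I. P i w s)"
  using assms
proof (induction I)
  case (insert i I)
  then have "definable_on E D W A k (\<lambda>w s. P i w s \<or> (\<exists>i\<in>I. P i w s))"
    by (intro definable_on_disj) auto
  then show ?case by simp
qed (simp add: definable_on_const)

context ZFC
begin

definition definable :: "nat \<Rightarrow> ((nat \<Rightarrow> 'a) \<Rightarrow> bool) \<Rightarrow> bool" where
  "definable k P \<longleftrightarrow> definable_on E (\<lambda>_::unit. UNIV) UNIV UNIV k (\<lambda>_. P)"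

abbreviation definable1 :: "('a \<Rightarrow> bool) \<Rightarrow> bool" where
  "definable1 P \<equiv> definable 1 (\<lambda>s. P (s 0))"

abbreviation definable2 :: "('a \<Rightarrow> 'a \<Rightarrow> bool) \<Rightarrow> bool" where
  "definable2 P \<equiv> definable 2 (\<lambda>s. P (s 0) (s 1))"

abbreviation definable3 :: "('a \<Rightarrow> 'a \<Rightarrow> 'a \<Rightarrow> bool) \<Rightarrow> bool" where
  "definable3 P \<equiv> definable 3 (\<lambda>s. P (s 0) (s 1) (s 2))"

lemma definable_Mem:
  "term_function UNIV k f \<Longrightarrow> term_function UNIV k g \<Longrightarrow> definable k (\<lambda>s. E (f s) (g s))"
  unfolding definable_def by (rule definable_on_Mem)

lemma definable_Eql:
  "term_function UNIV k f \<Longrightarrow> term_function UNIV k g \<Longrightarrow> definable k (\<lambda>s. f s = g s)"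
  unfolding definable_def by (rule definable_on_Eql)

lemma definable_not: "definable k P \<Longrightarrow> definable k (\<lambda>s. \<not> P s)"
  and definable_imp: "definable k P \<Longrightarrow> definable k Q \<Longrightarrow> definable k (\<lambda>s. P s \<longrightarrow> Q s)"
  and definable_conj: "definable k P \<Longrightarrow> definable k Q \<Longrightarrow> definable k (\<lambda>s. P s \<and> Q s)"
  and definable_disj: "definable k P \<Longrightarrow> definable k Q \<Longrightarrow> definable k (\<lambda>s. P s \<or> Q s)"
  and definable_iff: "definable k P \<Longrightarrow> definable k Q \<Longrightarrow> definable k (\<lambda>s. P s = Q s)"
  unfolding definable_def
  by (simp_all add: definable_on_not definable_on_imp definable_on_conj definable_on_disj
      definable_on_iff)

lemma
  assumes "definable (Suc k) (\<lambda>s. Q (s 0) (\<lambda>i. s (Suc i)))"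
  shows definable_all: "definable k (\<lambda>s. \<forall>x. Q x s)"
    and definable_ex: "definable k (\<lambda>s. \<exists>x. Q x s)"
  using assms unfolding definable_def
  using definable_on_all[of E "\<lambda>_::unit. UNIV" UNIV UNIV k "\<lambda>_. Q"]
    definable_on_ex[of E "\<lambda>_::unit. UNIV" UNIV UNIV k "\<lambda>_. Q"]
  by simp_all

lemma definable_subst:
  assumes "definable k P" "\<And>i. i < k \<Longrightarrow> term_function UNIV l (f i)"
  shows "definable l (\<lambda>s. P (\<lambda>i. f i s))"
  using definable_on_subst[OF assms[unfolded definable_def]] unfolding definable_def by simp

lemma definable1_subst:
  assumes "definable1 P" "term_function UNIV k f"
  shows "definable k (\<lambda>s. P (f s))"
  using definable_subst[OF assms(1), of k "\<lambda>_. f"] assms(2) by simp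

lemma definable2_subst:
  assumes "definable2 P" "term_function UNIV k f" "term_function UNIV k g"
  shows "definable k (\<lambda>s. P (f s) (g s))"
  using definable_subst[OF assms(1), of k "\<lambda>i. [f, g] ! i"] assms(2,3)
  by (simp add: nth_Cons split: nat.splits)

lemma definable3_subst:
  assumes "definable3 P" "term_function UNIV k f" "term_function UNIV k g" "term_function UNIV k h"
  shows "definable k (\<lambda>s. P (f s) (g s) (h s))"
  using definable_subst[OF assms(1), of k "\<lambda>i. [f, g, h] ! i"] assms(2-4)
  by (simp add: nth_Cons numeral_2_eq_2 less_Suc_eq split: nat.splits)

lemmas definable_intros = definable_Mem definable_Eql definable_not definable_imp definable_conj
  definable_disj definable_iff definable_all definable_ex
  term_function_Var term_function_Par[OF UNIV_I]

lemma definable_is_trans: "definable1 (is_trans E)"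
  unfolding is_trans_def by (intro definable_intros; simp)

lemma definable_is_Ord: "definable1 (is_Ord E)"
  unfolding is_Ord_def by (intro definable_intros definable1_subst[OF definable_is_trans]; simp)

lemma definable_is_upair: "definable3 (is_upair E)"
  unfolding is_upair_def by (intro definable_intros; simp)

lemma definable_is_opair: "definable3 (is_opair E)"
  unfolding is_opair_def by (intro definable_intros definable3_subst[OF definable_is_upair]; simp)

lemma definable_maps_to: "definable3 (maps_to E)"
  unfolding maps_to_def by (intro definable_intros definable3_subst[OF definable_is_opair]; simp)

lemmas definable_rules = definable_intros definable1_subst[OF definable_is_Ord]
  definable3_subst[OF definable_is_opair] definable3_subst[OF definable_maps_to]

text \<open>The parameters are replaced by variables from \<open>k\<close> on.\<close>

lemma definable_parameter_free:
  assumes "definable k P"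
  obtains \<phi> p where "nonmodal \<phi>" "params \<phi> = {}"
    "\<And>s. fo_sat E (\<lambda>i. if i < k then s i else p i) \<phi> = P s"
proof -
  obtain \<phi> where \<phi>: "nonmodal \<phi>" "fvars \<phi> \<subseteq> {..<k}"
    "\<And>s. sat E (\<lambda>_::unit. UNIV) (\<lambda>_ _. False) () s \<phi> = P s"
    using assms unfolding definable_def definable_on_def by auto
  obtain f :: "'a \<Rightarrow> nat" where f: "inj_on f (params \<phi>)"
    using finite_imp_inj_to_nat_seg[OF finite_params] by metis
  define p where "p i = inv_into (params \<phi>) f (i - k)" for i
  define \<tau> :: "'a trm \<Rightarrow> 'a trm"
    where "\<tau> t = (case t of Var i \<Rightarrow> Var i | Par a \<Rightarrow> Var (k + f a))" for t
  show ?thesis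
  proof (rule that[of "subst \<phi> \<tau>" p])
    show "nonmodal (subst \<phi> \<tau>)" using \<phi>(1) by (simp add: nonmodal_subst)
    have "tparams (\<tau> t) = {}" for t by (cases t) (auto simp: \<tau>_def)
    then show "params (subst \<phi> \<tau>) = {}" using params_subst_subset[of \<phi> \<tau> "{}" UNIV] by simp
    fix s
    let ?s = "\<lambda>i. if i < k then s i else p i"
    have "tval ?s (\<tau> (Par a)) = a" if "a \<in> params \<phi>" for a
      using f that by (simp add: \<tau>_def p_def)
    then have "fo_sat E ?s (subst \<phi> \<tau>)
        = sat E (\<lambda>_::unit. UNIV) (\<lambda>_ _. False) () (\<lambda>n. tval ?s (\<tau> (Var n))) \<phi>"
      unfolding fo_sat_def by (rule sat_subst)
    also have "\<dots> = sat E (\<lambda>_::unit. UNIV) (\<lambda>_ _. False) () s \<phi>"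
      using \<phi>(2) by (intro sat_cong) (auto simp: \<tau>_def)
    also have "\<dots> = P s" by (rule \<phi>(3))
    finally show "fo_sat E ?s (subst \<phi> \<tau>) = P s" .
  qed
qed

lemma separation_definable:
  assumes "definable1 P"
  shows "\<exists>b. \<forall>x. E x b \<longleftrightarrow> E x a \<and> P x"
proof -
  obtain \<phi> p where \<phi>: "nonmodal \<phi>" "params \<phi> = {}"
    "\<And>s. fo_sat E (\<lambda>i. if i < 1 then s i else p i) \<phi> = P (s 0)"
    using definable_parameter_free[OF assms] by blast
  have "fo_sat E (p(0 := x)) \<phi> = P x" for x
  proof -
    have "p(0 := x) = (\<lambda>i. if i < 1 then x else p i)" by auto
    then show ?thesis using \<phi>(3)[of "\<lambda>_. x"] by simp
  qed
  then show ?thesis using separation[OF \<phi>(1,2), of a p] by simp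
qed

lemma replacement_definable:
  assumes "definable2 F" "\<And>x. E x a \<Longrightarrow> \<exists>!y. F x y"
  shows "\<exists>b. \<forall>y. E y b \<longleftrightarrow> (\<exists>x. E x a \<and> F x y)"
proof -
  obtain \<phi> p where \<phi>: "nonmodal \<phi>" "params \<phi> = {}"
    "\<And>s. fo_sat E (\<lambda>i. if i < 2 then s i else p i) \<phi> = F (s 0) (s 1)"
    using definable_parameter_free[OF assms(1)] by blast
  have "fo_sat E (p(0 := x, 1 := y)) \<phi> = F x y" for x y
  proof -
    have "p(0 := x, 1 := y) = (\<lambda>i. if i < 2 then if i = 0 then x else y else p i)" by auto
    then show ?thesis using \<phi>(3)[of "\<lambda>i. if i = 0 then x else y"] by simp
  qed
  then show ?thesis using replacement[OF \<phi>(1,2), of a p] assms(2) by simp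
qed

section \<open>Sets and ordinals of the model\<close>

lemma ex1_set: "\<exists>b. \<forall>x. E x b \<longleftrightarrow> P x \<Longrightarrow> \<exists>!b. \<forall>x. E x b \<longleftrightarrow> P x"
  using extensionality by metis

definition collect :: "('a \<Rightarrow> bool) \<Rightarrow> 'a" where
  "collect P = (THE b. \<forall>x. E x b \<longleftrightarrow> P x)"

lemma mem_collect_iff: "\<exists>b. \<forall>x. E x b \<longleftrightarrow> P x \<Longrightarrow> E x (collect P) \<longleftrightarrow> P x"
  using theI'[OF ex1_set, of P] unfolding collect_def by blast

definition upair :: "'a \<Rightarrow> 'a \<Rightarrow> 'a" where
  "upair a b = collect (\<lambda>x. x = a \<or> x = b)"

definition opair :: "'a \<Rightarrow> 'a \<Rightarrow> 'a" where
  "opair a b = upair (upair a a) (upair a b)"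

definition union_of :: "'a \<Rightarrow> 'a" where
  "union_of a = collect (\<lambda>x. \<exists>y. E x y \<and> E y a)"

definition adjoin :: "'a \<Rightarrow> 'a \<Rightarrow> 'a" where
  "adjoin x a = union_of (upair a (upair x x))"

abbreviation succ :: "'a \<Rightarrow> 'a" where
  "succ x \<equiv> adjoin x x"

lemma mem_upair_iff: "E x (upair a b) \<longleftrightarrow> x = a \<or> x = b"
  unfolding upair_def by (rule mem_collect_iff[OF pairing])

lemma mem_union_of_iff: "E x (union_of a) \<longleftrightarrow> (\<exists>y. E x y \<and> E y a)"
  unfolding union_of_def by (rule mem_collect_iff[OF union])

lemma mem_adjoin_iff: "E z (adjoin x a) \<longleftrightarrow> z = x \<or> E z a"
  unfolding adjoin_def mem_union_of_iff mem_upair_iff by (metis mem_upair_iff)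

lemma is_upair_iff: "is_upair E a b c \<longleftrightarrow> c = upair a b"
  unfolding is_upair_def using extensionality[of c "upair a b"] by (auto simp: mem_upair_iff)

lemma is_opair_iff: "is_opair E a b c \<longleftrightarrow> c = opair a b"
  unfolding is_opair_def is_upair_iff opair_def by simp

lemma maps_to_iff: "maps_to E f x y \<longleftrightarrow> E (opair x y) f"
  unfolding maps_to_def is_opair_iff by simp

lemma upair_eq_iff: "upair a b = upair c d \<longleftrightarrow> (a = c \<and> b = d) \<or> (a = d \<and> b = c)"
proof
  assume "upair a b = upair c d"
  then have "\<And>x. (x = a \<or> x = b) = (x = c \<or> x = d)" using mem_upair_iff by metis
  then show "(a = c \<and> b = d) \<or> (a = d \<and> b = c)" by metis
next
  assume "(a = c \<and> b = d) \<or> (a = d \<and> b = c)"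
  then show "upair a b = upair c d" by (intro extensionality) (auto simp: mem_upair_iff)
qed

lemma opair_eq_iff: "opair a b = opair c d \<longleftrightarrow> a = c \<and> b = d"
  unfolding opair_def upair_eq_iff by auto

lemma maps_to_adjoin_iff:
  "maps_to E (adjoin (opair a b) f) x y \<longleftrightarrow> x = a \<and> y = b \<or> maps_to E f x y"
  unfolding maps_to_iff mem_adjoin_iff opair_eq_iff ..

lemma graph_exists:
  assumes "definable2 F" and F: "\<And>x. E x a \<Longrightarrow> \<exists>!y. F x y"
  shows "\<exists>f. \<forall>x y. maps_to E f x y \<longleftrightarrow> E x a \<and> F x y"
proof -
  have "definable2 (\<lambda>x q. \<exists>y. F x y \<and> is_opair E x y q)"
    by (intro definable_rules definable2_subst[OF assms(1)]; simp)
  moreover have "\<exists>!q. \<exists>y. F x y \<and> is_opair E x y q" if "E x a" for x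
    using F[OF that] unfolding is_opair_iff by metis
  ultimately obtain f where f: "\<And>q. E q f \<longleftrightarrow> (\<exists>x. E x a \<and> (\<exists>y. F x y \<and> is_opair E x y q))"
    using replacement_definable[of "\<lambda>x q. \<exists>y. F x y \<and> is_opair E x y q" a] by blast
  have "maps_to E f x y \<longleftrightarrow> E x a \<and> F x y" for x y
    unfolding maps_to_iff f is_opair_iff by (auto simp: opair_eq_iff)
  then show ?thesis by blast
qed

lemma image_exists:
  assumes "\<And>x. E x a \<Longrightarrow> \<exists>!y. maps_to E f x y"
  shows "\<exists>b. \<forall>y. E y b \<longleftrightarrow> (\<exists>x. E x a \<and> maps_to E f x y)"
proof (rule replacement_definable[OF _ assms])
  show "definable2 (maps_to E f)" by (intro definable_rules; simp)
qed

lemma mem_irrefl: "\<not> E x x"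
  using foundation[of x "upair x x"] by (auto simp: mem_upair_iff)

lemma mem_asym: "E x y \<Longrightarrow> \<not> E y x"
  using foundation[of x "upair x y"] by (auto simp: mem_upair_iff)

lemma succ_eq_iff: "a = succ b \<longleftrightarrow> E b a \<and> (\<forall>x. E x b \<longrightarrow> E x a) \<and> (\<forall>x. E x a \<longrightarrow> x = b \<or> E x b)"
  using extensionality[of a "succ b"] by (auto simp: mem_adjoin_iff)

lemma succ_inject: "succ a = succ b \<longleftrightarrow> a = b"
  using mem_asym mem_adjoin_iff by metis

abbreviation Ord :: "'a \<Rightarrow> bool" where
  "Ord \<equiv> is_Ord E"

lemma Ord_empty: "(\<And>x. \<not> E x a) \<Longrightarrow> Ord a"
  by (simp add: is_Ord_def is_trans_def)

lemma Ord_in: "Ord a \<Longrightarrow> E x a \<Longrightarrow> Ord x"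
  unfolding is_Ord_def is_trans_def by blast

lemma Ord_trans: "Ord c \<Longrightarrow> E a b \<Longrightarrow> E b c \<Longrightarrow> E a c"
  unfolding is_Ord_def is_trans_def by blast

lemma Ord_succ: "Ord a \<Longrightarrow> Ord (succ a)"
  unfolding is_Ord_def is_trans_def mem_adjoin_iff by blast

lemma Ord_union_of: "(\<And>x. E x a \<Longrightarrow> Ord x) \<Longrightarrow> Ord (union_of a)"
  unfolding is_Ord_def is_trans_def mem_union_of_iff by blast

lemma Ord_least:
  assumes "definable1 P" "Ord a" "P a"
  obtains m where "Ord m" "P m" "\<And>x. E x m \<Longrightarrow> \<not> P x"
proof -
  obtain b where b: "\<And>x. E x b \<longleftrightarrow> E x (succ a) \<and> P x"
    using separation_definable[OF assms(1)] by blast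
  have "E a b" using assms(3) by (simp add: b mem_adjoin_iff)
  then obtain m where m: "E m b" "\<not> (\<exists>z. E z m \<and> E z b)" using foundation by blast
  have succ_a: "Ord (succ a)" using Ord_succ assms(2) .
  have m_succ: "E m (succ a)" "P m" using m(1) b by auto
  have "\<not> P x" if "E x m" for x
    using m(2) that b Ord_trans[OF succ_a that] m_succ(1) by blast
  then show ?thesis using that Ord_in[OF succ_a] m_succ by blast
qed

lemma Ord_induct:
  assumes "definable1 P" "Ord a"
    and step: "\<And>a. Ord a \<Longrightarrow> (\<And>x. E x a \<Longrightarrow> P x) \<Longrightarrow> P a"
  shows "P a"
proof (rule ccontr)
  assume "\<not> P a"
  with assms(1,2) obtain m where "Ord m" "\<not> P m" "\<And>x. E x m \<Longrightarrow> \<not> \<not> P x"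
    using Ord_least[of "\<lambda>x. \<not> P x" a] definable_not by blast
  then show False using step by blast
qed

lemma Ord_linear:
  assumes "Ord a" "Ord b"
  shows "E a b \<or> a = b \<or> E b a"
proof -
  let ?comparable = "\<lambda>a b. E a b \<or> a = b \<or> E b a"
  have "\<forall>b. Ord b \<longrightarrow> ?comparable a b"
  proof (rule Ord_induct[where P = "\<lambda>a. \<forall>b. Ord b \<longrightarrow> ?comparable a b"])
    show "definable1 (\<lambda>a. \<forall>b. Ord b \<longrightarrow> ?comparable a b)" by (intro definable_rules; simp)
  next
    fix a assume a: "Ord a" and IH_a: "\<And>x. E x a \<Longrightarrow> \<forall>b. Ord b \<longrightarrow> ?comparable x b"
    have "?comparable a b" if "Ord b" for b
    proof (rule Ord_induct[where P = "\<lambda>b. ?comparable a b"])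
      show "definable1 (\<lambda>b. ?comparable a b)" by (intro definable_rules; simp)
    next
      fix b assume b: "Ord b" and IH_b: "\<And>x. E x b \<Longrightarrow> ?comparable a x"
      show "?comparable a b"
      proof (rule ccontr)
        assume incomparable: "\<not> ?comparable a b"
        have "E x a = E x b" for x
          using IH_a[of x] IH_b[of x] Ord_trans[OF a, of b x] Ord_trans[OF b, of a x] a b
            incomparable by metis
        then show False using extensionality[of a b] incomparable by blast
      qed
    qed (rule that)
    then show "\<forall>b. Ord b \<longrightarrow> ?comparable a b" by blast
  qed (rule assms(1))
  then show ?thesis using assms(2) by blast
qed

lemma Ord_subset: "Ord a \<Longrightarrow> Ord b \<Longrightarrow> (\<And>x. E x a \<Longrightarrow> E x b) \<Longrightarrow> E a b \<or> a = b"
  using Ord_linear mem_irrefl by blast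

lemma succ_le:
  assumes "Ord b" "E a b"
  shows "E (succ a) b \<or> succ a = b"
proof (rule Ord_subset[OF Ord_succ[OF Ord_in[OF assms]] assms(1)])
  show "E x b" if "E x (succ a)" for x
    using that assms Ord_trans[OF assms(1)] by (auto simp: mem_adjoin_iff)
qed

lemma ord_le_trans: "ord_le E a b \<Longrightarrow> ord_le E b c \<Longrightarrow> ord_le E a c"
  unfolding ord_le_def using Ord_trans by blast

lemma ordinals_bounded:
  obtains m where "Ord m" "\<And>x. E x a \<Longrightarrow> Ord x \<Longrightarrow> E x m"
proof -
  obtain b where b: "\<And>x. E x b \<longleftrightarrow> E x a \<and> Ord x"
    using separation_definable[OF definable_is_Ord] by blast
  have sup: "Ord (union_of b)" using b by (intro Ord_union_of) blast
  have "E x (succ (union_of b))" if "E x a" "Ord x" for x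
    using Ord_subset[OF that(2) sup] that b by (auto simp: mem_adjoin_iff mem_union_of_iff)
  then show ?thesis using that[OF Ord_succ[OF sup]] by blast
qed

definition is_least :: "('a \<Rightarrow> bool) \<Rightarrow> 'a \<Rightarrow> bool" where
  "is_least P v \<longleftrightarrow> P v \<and> (\<forall>u. E u v \<longrightarrow> \<not> P u)"

lemma ex1_is_least:
  assumes "definable1 P" and ord: "\<And>x. P x \<Longrightarrow> Ord x" and "P a"
  shows "\<exists>!v. is_least P v"
proof -
  obtain v where "P v" "\<And>u. E u v \<Longrightarrow> \<not> P u"
    by (rule Ord_least[OF assms(1) ord[OF assms(3)] assms(3)]) blast
  then have "is_least P v" by (simp add: is_least_def)
  moreover have "u = v" if "is_least P u" "is_least P v" for u v
    using that Ord_linear[OF ord ord, of u v] unfolding is_least_def by blast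
  ultimately show ?thesis by blast
qed

end

section \<open>Recursion on the ordinals of the model\<close>

locale definable_recursion = ZFC E for E :: "'a \<Rightarrow> 'a \<Rightarrow> bool" +
  fixes \<Phi> :: "'a \<Rightarrow> 'a \<Rightarrow> 'a \<Rightarrow> bool"
  assumes definable_clause: "definable3 \<Phi>"
    and clause_local: "(\<And>\<gamma> w. E \<gamma> \<alpha> \<Longrightarrow> maps_to E f \<gamma> w = maps_to E f' \<gamma> w) \<Longrightarrow> \<Phi> f \<alpha> v \<Longrightarrow> \<Phi> f' \<alpha> v"
    and clause_total: "Ord \<alpha> \<Longrightarrow> (\<And>\<gamma>. E \<gamma> \<alpha> \<Longrightarrow> \<exists>!w. maps_to E f \<gamma> w) \<Longrightarrow> \<exists>!v. \<Phi> f \<alpha> v"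
begin

definition attempt :: "'a \<Rightarrow> 'a \<Rightarrow> bool" where
  "attempt \<beta> f \<longleftrightarrow> (\<forall>\<alpha>. E \<alpha> \<beta> \<or> \<alpha> = \<beta> \<longrightarrow>
    (\<exists>!v. maps_to E f \<alpha> v) \<and> (\<forall>v. maps_to E f \<alpha> v \<longrightarrow> \<Phi> f \<alpha> v))"

lemma attempt_value: "attempt \<beta> f \<Longrightarrow> E \<alpha> \<beta> \<or> \<alpha> = \<beta> \<Longrightarrow> \<exists>!v. maps_to E f \<alpha> v"
  unfolding attempt_def by blast

lemma attempt_clause: "attempt \<beta> f \<Longrightarrow> E \<alpha> \<beta> \<or> \<alpha> = \<beta> \<Longrightarrow> maps_to E f \<alpha> v \<Longrightarrow> \<Phi> f \<alpha> v"
  unfolding attempt_def by blast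

lemma definable_attempt: "definable2 attempt"
  unfolding attempt_def Ex1_def
  by (intro definable_rules definable3_subst[OF definable_clause]; simp)

lemma attempt_mono: "attempt \<beta> f \<Longrightarrow> Ord \<beta> \<Longrightarrow> E \<alpha> \<beta> \<Longrightarrow> attempt \<alpha> f"
  using Ord_trans[of \<beta> _ \<alpha>] unfolding attempt_def by (simp; metis)

lemma attempt_unique:
  assumes "Ord \<alpha>" "attempt \<alpha> f" "attempt \<alpha> f'"
  shows "maps_to E f \<alpha> v = maps_to E f' \<alpha> v"
proof -
  have "attempt \<alpha> f \<and> attempt \<alpha> f' \<longrightarrow> (\<forall>v. maps_to E f \<alpha> v = maps_to E f' \<alpha> v)"
  proof (rule Ord_induct[where
        P = "\<lambda>\<alpha>. attempt \<alpha> f \<and> attempt \<alpha> f' \<longrightarrow> (\<forall>v. maps_to E f \<alpha> v = maps_to E f' \<alpha> v)"])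
    show "definable1 (\<lambda>\<alpha>. attempt \<alpha> f \<and> attempt \<alpha> f' \<longrightarrow>
        (\<forall>v. maps_to E f \<alpha> v = maps_to E f' \<alpha> v))"
      by (intro definable_rules definable2_subst[OF definable_attempt]; simp)
  next
    fix a assume a: "Ord a"
      and IH: "\<And>x. E x a \<Longrightarrow> attempt x f \<and> attempt x f' \<longrightarrow>
        (\<forall>v. maps_to E f x v = maps_to E f' x v)"
    show "attempt a f \<and> attempt a f' \<longrightarrow> (\<forall>v. maps_to E f a v = maps_to E f' a v)"
    proof (intro impI, elim conjE)
      assume f: "attempt a f" and f': "attempt a f'"
      have agree: "maps_to E f \<gamma> w = maps_to E f' \<gamma> w" if "E \<gamma> a" for \<gamma> w
        using IH[OF that] attempt_mono[OF f a that] attempt_mono[OF f' a that] by blast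
      obtain u where u: "\<And>v. maps_to E f a v \<longleftrightarrow> v = u" "\<Phi> f a u"
        using attempt_value[OF f] attempt_clause[OF f] by metis
      obtain u' where u': "\<And>v. maps_to E f' a v \<longleftrightarrow> v = u'" "\<Phi> f' a u'"
        using attempt_value[OF f'] attempt_clause[OF f'] by metis
      have "\<Phi> f a u'" using clause_local[OF _ u'(2)] agree by blast
      moreover have "\<exists>!v. \<Phi> f a v"
        using attempt_value[OF f] by (intro clause_total a) blast
      ultimately have "u = u'" using u(2) by blast
      then show "\<forall>v. maps_to E f a v = maps_to E f' a v" by (simp add: u(1) u'(1))
    qed
  qed (rule assms(1))
  then show ?thesis using assms(2,3) by blast
qed

definition recursion_value :: "'a \<Rightarrow> 'a \<Rightarrow> bool" where
  "recursion_value \<gamma> v \<longleftrightarrow> (\<exists>f. attempt \<gamma> f \<and> maps_to E f \<gamma> v)"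

lemma definable_recursion_value: "definable2 recursion_value"
  unfolding recursion_value_def
  by (intro definable_rules definable2_subst[OF definable_attempt]; simp)

lemma recursion_value_iff: "Ord \<gamma> \<Longrightarrow> attempt \<gamma> f \<Longrightarrow> recursion_value \<gamma> v \<longleftrightarrow> maps_to E f \<gamma> v"
  using attempt_unique unfolding recursion_value_def by blast

lemma attempt_extend:
  assumes \<beta>: "Ord \<beta>" and earlier: "\<And>\<gamma>. E \<gamma> \<beta> \<Longrightarrow> \<exists>f. attempt \<gamma> f"
    and g: "\<And>\<gamma> v. maps_to E g \<gamma> v \<longleftrightarrow> E \<gamma> \<beta> \<and> recursion_value \<gamma> v"
    and v0: "\<Phi> g \<beta> v0"
  shows "attempt \<beta> (adjoin (opair \<beta> v0) g)"
proof -
  define h where "h = adjoin (opair \<beta> v0) g"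
  have h_below: "maps_to E h \<gamma> v \<longleftrightarrow> recursion_value \<gamma> v" if "E \<gamma> \<beta>" for \<gamma> v
    using that mem_irrefl by (auto simp: h_def maps_to_adjoin_iff g)
  have h_top: "maps_to E h \<beta> v \<longleftrightarrow> v = v0" for v
    using mem_irrefl by (auto simp: h_def maps_to_adjoin_iff g)
  have "(\<exists>!v. maps_to E h \<alpha> v) \<and> (\<forall>v. maps_to E h \<alpha> v \<longrightarrow> \<Phi> h \<alpha> v)"
    if \<alpha>: "E \<alpha> \<beta>" for \<alpha>
  proof -
    note \<alpha>_Ord = Ord_in[OF \<beta> \<alpha>]
    obtain f where f: "attempt \<alpha> f" using earlier[OF \<alpha>] by blast
    have agree: "maps_to E f \<gamma> v = maps_to E h \<gamma> v" if \<gamma>: "E \<gamma> \<alpha> \<or> \<gamma> = \<alpha>" for \<gamma> v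
    proof -
      have "E \<gamma> \<beta>" "attempt \<gamma> f"
        using \<gamma> \<alpha> f Ord_trans[OF \<beta>] attempt_mono[OF f \<alpha>_Ord] by blast+
      then show ?thesis using recursion_value_iff[OF Ord_in[OF \<beta>]] h_below by blast
    qed
    have "\<Phi> h \<alpha> v" if "maps_to E h \<alpha> v" for v
    proof (rule clause_local)
      show "\<Phi> f \<alpha> v" using attempt_clause[OF f] that agree[of \<alpha> v] by blast
    qed (use agree in blast)
    moreover have "\<exists>!v. maps_to E h \<alpha> v"
      using attempt_value[OF f, of \<alpha>] by (simp add: agree)
    ultimately show ?thesis by blast
  qed
  moreover have "\<Phi> h \<beta> v0" using clause_local[OF _ v0] h_below g by blast
  ultimately show ?thesis unfolding attempt_def h_def[symmetric] using h_top by auto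
qed

lemma attempt_exists:
  assumes "Ord \<beta>"
  shows "\<exists>f. attempt \<beta> f"
proof (rule Ord_induct[where P = "\<lambda>\<beta>. \<exists>f. attempt \<beta> f"])
  show "definable1 (\<lambda>\<beta>. \<exists>f. attempt \<beta> f)"
    by (intro definable_rules definable2_subst[OF definable_attempt]; simp)
next
  fix \<beta> assume \<beta>: "Ord \<beta>" and IH: "\<And>\<gamma>. E \<gamma> \<beta> \<Longrightarrow> \<exists>f. attempt \<gamma> f"
  have value_ex1: "\<exists>!v. recursion_value \<gamma> v" if \<gamma>: "E \<gamma> \<beta>" for \<gamma>
  proof -
    obtain f where f: "attempt \<gamma> f" using IH[OF \<gamma>] by blast
    then have "\<exists>!v. maps_to E f \<gamma> v" using attempt_value by blast
    then show ?thesis using recursion_value_iff[OF Ord_in[OF \<beta> \<gamma>] f] by simp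
  qed
  then obtain g where g: "\<And>\<gamma> v. maps_to E g \<gamma> v \<longleftrightarrow> E \<gamma> \<beta> \<and> recursion_value \<gamma> v"
    using graph_exists[OF definable_recursion_value] by blast
  have "\<exists>!v. \<Phi> g \<beta> v" using value_ex1 by (intro clause_total \<beta>) (simp add: g)
  then obtain v0 where "\<Phi> g \<beta> v0" by blast
  then show "\<exists>f. attempt \<beta> f" using attempt_extend[OF \<beta> IH g] by blast
qed (rule assms)

end

section \<open>The cumulative hierarchy\<close>

context ZFC
begin

definition rank_clause :: "'a \<Rightarrow> 'a \<Rightarrow> 'a \<Rightarrow> bool" where
  "rank_clause f \<alpha> v \<longleftrightarrow>
    (\<forall>x. E x v \<longleftrightarrow> (\<exists>\<gamma> w. E \<gamma> \<alpha> \<and> maps_to E f \<gamma> w \<and> (\<forall>y. E y x \<longrightarrow> E y w)))"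

lemma rank_clause_total:
  assumes f: "\<And>\<gamma>. E \<gamma> \<alpha> \<Longrightarrow> \<exists>!w. maps_to E f \<gamma> w"
  shows "\<exists>!v. rank_clause f \<alpha> v"
proof -
  let ?power = "\<lambda>w q. \<forall>x. E x q \<longleftrightarrow> (\<forall>y. E y x \<longrightarrow> E y w)"
  have power: "\<exists>!q. ?power w q" for w by (rule ex1_set[OF powerset])
  let ?F = "\<lambda>\<gamma> q. \<exists>w. maps_to E f \<gamma> w \<and> ?power w q"
  have "definable2 ?F" by (intro definable_rules; simp)
  moreover have "\<exists>!q. ?F \<gamma> q" if \<gamma>: "E \<gamma> \<alpha>" for \<gamma>
  proof -
    obtain w where "\<And>v. maps_to E f \<gamma> v \<longleftrightarrow> v = w" using f[OF \<gamma>] by metis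
    then show ?thesis using power[of w] by simp
  qed
  ultimately obtain A where A: "\<And>q. E q A \<longleftrightarrow> (\<exists>\<gamma>. E \<gamma> \<alpha> \<and> ?F \<gamma> q)"
    using replacement_definable[of ?F \<alpha>] by blast
  have "(\<exists>q. E x q \<and> ?power w q) \<longleftrightarrow> (\<forall>y. E y x \<longrightarrow> E y w)" for x w
    using powerset[of w] by blast
  moreover have "E x (union_of A) \<longleftrightarrow>
      (\<exists>\<gamma> w. E \<gamma> \<alpha> \<and> maps_to E f \<gamma> w \<and> (\<exists>q. E x q \<and> ?power w q))" for x
    unfolding mem_union_of_iff A by blast
  ultimately have "rank_clause f \<alpha> (union_of A)" by (simp add: rank_clause_def)
  then show ?thesis unfolding rank_clause_def by (intro ex1_set) blast
qed

lemma definable_recursion_rank_clause: "definable_recursion E rank_clause"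
proof unfold_locales
  show "definable3 rank_clause" unfolding rank_clause_def by (intro definable_rules; simp)
next
  fix \<alpha> f f' v
  assume "\<And>\<gamma> w. E \<gamma> \<alpha> \<Longrightarrow> maps_to E f \<gamma> w = maps_to E f' \<gamma> w" "rank_clause f \<alpha> v"
  then show "rank_clause f' \<alpha> v" unfolding rank_clause_def by (simp cong: conj_cong)
qed (rule rank_clause_total)

interpretation rank: definable_recursion E rank_clause
  by (rule definable_recursion_rank_clause)

lemma rank_seq_iff_attempt: "rank_seq E = rank.attempt"
  by (intro ext) (simp only: rank_seq_def rank.attempt_def rank_clause_def)

lemmas rank_seq_exists = rank.attempt_exists[folded rank_seq_iff_attempt]
lemmas rank_seq_value = rank.attempt_value[folded rank_seq_iff_attempt]
lemmas rank_seq_clause = rank.attempt_clause[folded rank_seq_iff_attempt]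
lemmas rank_seq_mono = rank.attempt_mono[folded rank_seq_iff_attempt]
lemmas rank_seq_unique = rank.attempt_unique[folded rank_seq_iff_attempt]

lemma mem_Vseg_iff_rank_seq:
  assumes "Ord \<beta>" "rank_seq E \<beta> f" "maps_to E f \<beta> v"
  shows "x \<in> Vseg E \<beta> \<longleftrightarrow> E x v"
proof
  assume "x \<in> Vseg E \<beta>"
  then obtain g w where g: "rank_seq E \<beta> g" "maps_to E g \<beta> w" "E x w" by (auto simp: Vseg_def)
  then have "maps_to E f \<beta> w" using rank_seq_unique[OF assms(1,2) g(1)] by blast
  moreover have "\<exists>!v. maps_to E f \<beta> v" using rank_seq_value[OF assms(2)] by blast
  ultimately show "E x v" using assms(3) g(3) by blast
qed (use assms in \<open>auto simp: Vseg_def\<close>)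

lemma Vseg_iff:
  assumes \<beta>: "Ord \<beta>"
  shows "x \<in> Vseg E \<beta> \<longleftrightarrow> (\<exists>\<gamma>. E \<gamma> \<beta> \<and> (\<forall>y. E y x \<longrightarrow> y \<in> Vseg E \<gamma>))"
proof -
  obtain f where f: "rank_seq E \<beta> f" using rank_seq_exists \<beta> by blast
  have earlier: "(\<exists>w. maps_to E f \<gamma> w \<and> (\<forall>y. E y x \<longrightarrow> E y w)) \<longleftrightarrow> (\<forall>y. E y x \<longrightarrow> y \<in> Vseg E \<gamma>)"
    if \<gamma>: "E \<gamma> \<beta>" for \<gamma>
  proof -
    obtain w where w: "\<And>w'. maps_to E f \<gamma> w' \<longleftrightarrow> w' = w" using rank_seq_value[OF f, of \<gamma>] \<gamma> by metis
    have "y \<in> Vseg E \<gamma> \<longleftrightarrow> E y w" for y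
      by (rule mem_Vseg_iff_rank_seq[OF Ord_in[OF \<beta> \<gamma>] rank_seq_mono[OF f \<beta> \<gamma>]]) (simp add: w)
    then show ?thesis by (simp add: w)
  qed
  obtain v where v: "maps_to E f \<beta> v" using rank_seq_value[OF f] by blast
  have "x \<in> Vseg E \<beta> \<longleftrightarrow> E x v" by (rule mem_Vseg_iff_rank_seq[OF \<beta> f v])
  also have "\<dots> \<longleftrightarrow> (\<exists>\<gamma> w. E \<gamma> \<beta> \<and> maps_to E f \<gamma> w \<and> (\<forall>y. E y x \<longrightarrow> E y w))"
    using rank_seq_clause[OF f _ v] by (simp add: rank_clause_def)
  also have "\<dots> \<longleftrightarrow> (\<exists>\<gamma>. E \<gamma> \<beta> \<and> (\<exists>w. maps_to E f \<gamma> w \<and> (\<forall>y. E y x \<longrightarrow> E y w)))"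
    by simp
  also have "\<dots> \<longleftrightarrow> (\<exists>\<gamma>. E \<gamma> \<beta> \<and> (\<forall>y. E y x \<longrightarrow> y \<in> Vseg E \<gamma>))"
    by (intro ex_cong1 conj_cong refl earlier)
  finally show ?thesis .
qed

lemma Vseg_mono: "Ord \<beta> \<Longrightarrow> E \<gamma> \<beta> \<Longrightarrow> x \<in> Vseg E \<gamma> \<Longrightarrow> x \<in> Vseg E \<beta>"
  using Vseg_iff[of \<beta> x] Vseg_iff[of \<gamma> x] Ord_in[of \<beta> \<gamma>] Ord_trans[of \<beta> _ \<gamma>] by blast

lemma Vseg_transitive: "Ord \<beta> \<Longrightarrow> x \<in> Vseg E \<beta> \<Longrightarrow> E y x \<Longrightarrow> y \<in> Vseg E \<beta>"
  using Vseg_iff[of \<beta> x] Vseg_mono[of \<beta> _ y] by blast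

lemma definable_Vseg: "definable2 (\<lambda>x \<beta>. x \<in> Vseg E \<beta>)"
  unfolding Vseg_def mem_Collect_eq rank_seq_def Ex1_def by (intro definable_rules; simp)

lemma mem_Ord_imp_mem_Vseg:
  assumes "Ord \<beta>" "E \<alpha> \<beta>"
  shows "\<alpha> \<in> Vseg E \<beta>"
proof -
  have "\<forall>\<alpha>. E \<alpha> \<beta> \<longrightarrow> \<alpha> \<in> Vseg E \<beta>"
  proof (rule Ord_induct[where P = "\<lambda>\<beta>. \<forall>\<alpha>. E \<alpha> \<beta> \<longrightarrow> \<alpha> \<in> Vseg E \<beta>"])
    show "definable1 (\<lambda>\<beta>. \<forall>\<alpha>. E \<alpha> \<beta> \<longrightarrow> \<alpha> \<in> Vseg E \<beta>)"
      by (intro definable_rules definable2_subst[OF definable_Vseg]; simp)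
  next
    fix b assume b: "Ord b" and "\<And>x. E x b \<Longrightarrow> \<forall>\<alpha>. E \<alpha> x \<longrightarrow> \<alpha> \<in> Vseg E x"
    then show "\<forall>\<alpha>. E \<alpha> b \<longrightarrow> \<alpha> \<in> Vseg E b" unfolding Vseg_iff[OF b] by blast
  qed (rule assms(1))
  then show ?thesis using assms(2) by blast
qed

lemma Ord_mem_Vseg_imp_mem:
  assumes "Ord \<beta>" "Ord \<alpha>" "\<alpha> \<in> Vseg E \<beta>"
  shows "E \<alpha> \<beta>"
proof -
  have "\<forall>\<alpha>. Ord \<alpha> \<and> \<alpha> \<in> Vseg E \<beta> \<longrightarrow> E \<alpha> \<beta>"
  proof (rule Ord_induct[where P = "\<lambda>\<beta>. \<forall>\<alpha>. Ord \<alpha> \<and> \<alpha> \<in> Vseg E \<beta> \<longrightarrow> E \<alpha> \<beta>"])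
    show "definable1 (\<lambda>\<beta>. \<forall>\<alpha>. Ord \<alpha> \<and> \<alpha> \<in> Vseg E \<beta> \<longrightarrow> E \<alpha> \<beta>)"
      by (intro definable_rules definable2_subst[OF definable_Vseg]; simp)
  next
    fix b assume b: "Ord b" and IH: "\<And>x. E x b \<Longrightarrow> \<forall>\<alpha>. Ord \<alpha> \<and> \<alpha> \<in> Vseg E x \<longrightarrow> E \<alpha> x"
    have "E \<alpha> b" if \<alpha>: "Ord \<alpha>" "\<alpha> \<in> Vseg E b" for \<alpha>
    proof -
      obtain \<gamma> where \<gamma>: "E \<gamma> b" "\<forall>y. E y \<alpha> \<longrightarrow> y \<in> Vseg E \<gamma>" using \<alpha>(2) Vseg_iff[OF b] by blast
      then have "E \<alpha> \<gamma> \<or> \<alpha> = \<gamma>"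
        using IH[OF \<gamma>(1)] Ord_in[OF \<alpha>(1)] by (intro Ord_subset \<alpha>(1) Ord_in[OF b]) blast+
      then show ?thesis using Ord_trans[OF b _ \<gamma>(1)] \<gamma>(1) by blast
    qed
    then show "\<forall>\<alpha>. Ord \<alpha> \<and> \<alpha> \<in> Vseg E b \<longrightarrow> E \<alpha> b" by blast
  qed (rule assms(1))
  then show ?thesis using assms(2,3) by blast
qed

lemma mem_Ord_iff: "Ord \<beta> \<Longrightarrow> E \<alpha> \<beta> \<longleftrightarrow> \<alpha> \<in> Vseg E \<beta> \<and> Ord \<alpha>"
  using mem_Ord_imp_mem_Vseg Ord_mem_Vseg_imp_mem Ord_in by blast

end

section \<open>Limits of definable classes of ordinals\<close>

context ZFC
begin

definition limit_of :: "('a \<Rightarrow> bool) \<Rightarrow> 'a \<Rightarrow> bool" where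
  "limit_of C \<delta> \<longleftrightarrow> Ord \<delta> \<and> (\<exists>x. E x \<delta> \<and> C x) \<and>
    (\<forall>x. E x \<delta> \<longrightarrow> (\<exists>y. E y \<delta> \<and> E x y \<and> C y))"

abbreviation limit :: "'a \<Rightarrow> bool" where
  "limit \<equiv> limit_of Ord"

abbreviation limit2 :: "'a \<Rightarrow> bool" where
  "limit2 \<equiv> limit_of limit"

definition unbounded_class :: "('a \<Rightarrow> bool) \<Rightarrow> bool" where
  "unbounded_class C \<longleftrightarrow> (\<forall>x. C x \<longrightarrow> Ord x) \<and> (\<forall>\<delta>. Ord \<delta> \<longrightarrow> (\<exists>c. C c \<and> E \<delta> c))"

lemma limit_of_Ord: "limit_of C \<delta> \<Longrightarrow> Ord \<delta>"
  by (simp add: limit_of_def)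

lemma limit_of_cofinal: "limit_of C \<delta> \<Longrightarrow> E x \<delta> \<Longrightarrow> \<exists>y. E y \<delta> \<and> E x y \<and> C y"
  by (simp add: limit_of_def)

lemma limit_of_succ_closed:
  assumes "limit_of C \<delta>" "E x \<delta>"
  shows "E (succ x) \<delta>"
proof -
  obtain y where y: "E y \<delta>" "E x y" using limit_of_cofinal[OF assms] by blast
  note \<delta> = limit_of_Ord[OF assms(1)]
  have "E (succ x) y \<or> succ x = y" using succ_le[OF Ord_in[OF \<delta> y(1)] y(2)] .
  then show ?thesis using y(1) Ord_trans[OF \<delta> _ y(1)] by blast
qed

lemma limit_of_neq_succ: "limit_of C \<delta> \<Longrightarrow> \<delta> \<noteq> succ \<gamma>"
  using limit_of_succ_closed[of C \<delta> \<gamma>] mem_irrefl mem_adjoin_iff by metis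

lemma limit_of_union_of:
  assumes "E c A" and C: "\<And>w. E w A \<Longrightarrow> C w \<and> Ord w"
    and cofinal: "\<And>w. E w A \<Longrightarrow> \<exists>w'. E w' A \<and> E w w'"
  shows "limit_of C (union_of A)"
  unfolding limit_of_def
proof (intro conjI allI impI)
  show "Ord (union_of A)" using C by (intro Ord_union_of) blast
  show "\<exists>x. E x (union_of A) \<and> C x"
    using C cofinal[OF assms(1)] assms(1) mem_union_of_iff by blast
  fix x assume "E x (union_of A)"
  then obtain w where "E x w" "E w A" using mem_union_of_iff by blast
  then show "\<exists>y. E y (union_of A) \<and> E x y \<and> C y"
    using C cofinal mem_union_of_iff by blast
qed

lemma definable_limit_of:
  assumes "definable1 C"
  shows "definable1 (limit_of C)"
  unfolding limit_of_def by (intro definable_rules definable1_subst[OF assms]; simp)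

lemma limit_exists:
  obtains \<mu> where "limit \<mu>"
proof -
  obtain a e where a: "E e a" "\<And>x. \<not> E x e"
    "\<And>x. E x a \<Longrightarrow> \<exists>y. E y a \<and> (\<forall>z. E z y \<longleftrightarrow> E z x \<or> z = x)"
    using infinity by blast
  have "definable1 (\<lambda>x. Ord x \<and> (\<forall>y. E y x \<longrightarrow> E y a))" by (intro definable_rules; simp)
  then obtain b where b: "\<And>x. E x b \<longleftrightarrow> E x a \<and> Ord x \<and> (\<forall>y. E y x \<longrightarrow> E y a)"
    using separation_definable[of "\<lambda>x. Ord x \<and> (\<forall>y. E y x \<longrightarrow> E y a)" a] by blast
  have "E (succ x) a" if "E x a" for x
  proof -
    obtain y where y: "E y a" "\<forall>z. E z y \<longleftrightarrow> E z x \<or> z = x" using a(3) \<open>E x a\<close> by blast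
    then have "y = succ x" by (intro extensionality) (auto simp: mem_adjoin_iff)
    then show ?thesis using y(1) by simp
  qed
  then have succ_b: "E (succ x) b" if "E x b" for x
    using that Ord_succ unfolding b mem_adjoin_iff by blast
  have "Ord b" unfolding is_Ord_def is_trans_def b using Ord_in Ord_trans by blast
  moreover have "E e b" using a Ord_empty unfolding b by blast
  ultimately have "limit b"
    unfolding limit_of_def using succ_b Ord_in mem_adjoin_iff by blast
  then show ?thesis by (rule that)
qed

definition enumeration_clause :: "('a \<Rightarrow> bool) \<Rightarrow> 'a \<Rightarrow> 'a \<Rightarrow> 'a \<Rightarrow> 'a \<Rightarrow> bool" where
  "enumeration_clause C \<delta> f \<alpha> = is_least (\<lambda>v. C v \<and> E \<delta> v \<and>
    (\<forall>\<gamma> w. E \<gamma> \<alpha> \<and> maps_to E f \<gamma> w \<and> Ord w \<longrightarrow> E w v))"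

lemma enumeration_clause_total:
  assumes C: "unbounded_class C" "definable1 C" and "Ord \<delta>"
    and f: "\<And>\<gamma>. E \<gamma> \<alpha> \<Longrightarrow> \<exists>!w. maps_to E f \<gamma> w"
  shows "\<exists>!v. enumeration_clause C \<delta> f \<alpha> v"
proof -
  have C_Ord: "Ord c" if "C c" for c using C(1) that by (simp add: unbounded_class_def)
  obtain A where A: "\<And>w. E w A \<longleftrightarrow> (\<exists>\<gamma>. E \<gamma> \<alpha> \<and> maps_to E f \<gamma> w)"
    using image_exists[OF f] by blast
  obtain m where m: "Ord m" "\<And>x. E x (adjoin \<delta> A) \<Longrightarrow> Ord x \<Longrightarrow> E x m"
    by (rule ordinals_bounded) blast
  obtain c where c: "C c" "E m c" using C(1) m(1) unfolding unbounded_class_def by blast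
  have above: "E x c" if "E x (adjoin \<delta> A)" "Ord x" for x
    using Ord_trans[OF C_Ord[OF c(1)] m(2)[OF that] c(2)] .
  show ?thesis
    unfolding enumeration_clause_def
  proof (rule ex1_is_least)
    show "definable1 (\<lambda>v. C v \<and> E \<delta> v \<and>
        (\<forall>\<gamma> w. E \<gamma> \<alpha> \<and> maps_to E f \<gamma> w \<and> Ord w \<longrightarrow> E w v))"
      by (intro definable_rules definable1_subst[OF C(2)]; simp)
    show "C c \<and> E \<delta> c \<and> (\<forall>\<gamma> w. E \<gamma> \<alpha> \<and> maps_to E f \<gamma> w \<and> Ord w \<longrightarrow> E w c)"
      using c(1) above assms(3) A mem_adjoin_iff by blast
  qed (use C_Ord in blast)
qed

lemma definable_recursion_enumeration_clause:
  assumes "unbounded_class C" "definable1 C" "Ord \<delta>"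
  shows "definable_recursion E (enumeration_clause C \<delta>)"
proof unfold_locales
  show "definable3 (enumeration_clause C \<delta>)"
    unfolding enumeration_clause_def is_least_def
    by (intro definable_rules definable1_subst[OF assms(2)]; simp)
next
  fix \<alpha> f f' v
  assume agree: "\<And>\<gamma> w. E \<gamma> \<alpha> \<Longrightarrow> maps_to E f \<gamma> w = maps_to E f' \<gamma> w"
    and "enumeration_clause C \<delta> f \<alpha> v"
  moreover have "enumeration_clause C \<delta> f \<alpha> = enumeration_clause C \<delta> f' \<alpha>"
    unfolding enumeration_clause_def by (simp add: agree cong: conj_cong)
  ultimately show "enumeration_clause C \<delta> f' \<alpha> v" by simp
qed (rule enumeration_clause_total[OF assms])

text \<open>The first \<open>\<mu>\<close> elements of \<open>C\<close> above \<open>\<delta>\<close>, for \<open>\<mu>\<close> a limit, form such a set.\<close>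

lemma unbounded_class_ascending_set:
  assumes C: "unbounded_class C" "definable1 C" and "Ord \<delta>"
  obtains A where "\<exists>c. E c A" "\<And>w. E w A \<Longrightarrow> C w \<and> E \<delta> w"
    "\<And>w. E w A \<Longrightarrow> \<exists>w'. E w' A \<and> E w w'"
proof -
  interpret enum: definable_recursion E "enumeration_clause C \<delta>"
    by (rule definable_recursion_enumeration_clause[OF assms])
  obtain \<mu> where \<mu>: "limit \<mu>" by (rule limit_exists)
  obtain f where f: "enum.attempt \<mu> f" using enum.attempt_exists[OF limit_of_Ord[OF \<mu>]] by blast
  have f_value: "\<exists>!w. maps_to E f \<gamma> w" if "E \<gamma> \<mu>" for \<gamma>
    using enum.attempt_value[OF f] that by blast
  have C_f: "C w \<and> E \<delta> w" and f_less: "\<And>\<gamma>' w'. E \<gamma>' \<gamma> \<Longrightarrow> maps_to E f \<gamma>' w' \<Longrightarrow> Ord w' \<Longrightarrow> E w' w"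
    if "E \<gamma> \<mu>" "maps_to E f \<gamma> w" for \<gamma> w
    using enum.attempt_clause[OF f _ that(2)] that(1)
    unfolding enumeration_clause_def is_least_def by blast+
  obtain A where A: "\<And>w. E w A \<longleftrightarrow> (\<exists>\<gamma>. E \<gamma> \<mu> \<and> maps_to E f \<gamma> w)"
    using image_exists[OF f_value] by blast
  have C_A: "C w \<and> E \<delta> w" if "E w A" for w using that A C_f by blast
  have "\<exists>w'. E w' A \<and> E w w'" if w: "E w A" for w
  proof -
    obtain \<gamma> where \<gamma>: "E \<gamma> \<mu>" "maps_to E f \<gamma> w" using A w by blast
    obtain \<gamma>' where \<gamma>': "E \<gamma>' \<mu>" "E \<gamma> \<gamma>'" using limit_of_cofinal[OF \<mu> \<gamma>(1)] by blast
    obtain w' where w': "maps_to E f \<gamma>' w'" using f_value[OF \<gamma>'(1)] by blast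
    have "Ord w" using C(1) C_A[OF w] by (simp add: unbounded_class_def)
    then show ?thesis using f_less[OF \<gamma>'(1) w' \<gamma>'(2) \<gamma>(2)] A \<gamma>'(1) w' by blast
  qed
  moreover obtain \<gamma> where "E \<gamma> \<mu>" using \<mu> unfolding limit_of_def by blast
  then have "\<exists>c. E c A" using f_value A by blast
  ultimately show ?thesis using that C_A by blast
qed

lemma unbounded_class_limit_of:
  assumes C: "unbounded_class C" "definable1 C"
  shows "unbounded_class (limit_of C)"
proof -
  have "\<exists>l. limit_of C l \<and> E \<delta> l" if \<delta>: "Ord \<delta>" for \<delta>
  proof -
    obtain A c where A: "E c A" "\<And>w. E w A \<Longrightarrow> C w \<and> E \<delta> w"
      "\<And>w. E w A \<Longrightarrow> \<exists>w'. E w' A \<and> E w w'"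
      using unbounded_class_ascending_set[OF C \<delta>] by metis
    have "limit_of C (union_of A)"
      by (rule limit_of_union_of[OF A(1)]) (use A C(1) in \<open>auto simp: unbounded_class_def\<close>)
    moreover have "E \<delta> (union_of A)" using A(1,2) mem_union_of_iff by blast
    ultimately show ?thesis by blast
  qed
  then show ?thesis using limit_of_Ord by (simp add: unbounded_class_def)
qed

lemma definable_limit2: "definable1 limit2"
  by (intro definable_limit_of definable_is_Ord)

lemma unbounded_class_limit2: "unbounded_class limit2"
proof -
  have "unbounded_class Ord"
    unfolding unbounded_class_def using Ord_succ mem_adjoin_iff by blast
  then show ?thesis
    by (intro unbounded_class_limit_of definable_limit_of definable_is_Ord)
qed

definition next_limit2 :: "'a \<Rightarrow> 'a \<Rightarrow> bool" where
  "next_limit2 \<delta> = is_least (\<lambda>\<mu>. limit2 \<mu> \<and> E \<delta> \<mu>)"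

lemma next_limit2_exists:
  assumes "Ord \<delta>"
  obtains \<mu> where "next_limit2 \<delta> \<mu>"
proof -
  obtain l where "limit2 l \<and> E \<delta> l"
    using unbounded_class_limit2 assms unfolding unbounded_class_def by blast
  moreover have "definable1 (\<lambda>\<mu>. limit2 \<mu> \<and> E \<delta> \<mu>)"
    by (intro definable_rules definable1_subst[OF definable_limit2]; simp)
  ultimately show ?thesis
    using that ex1_is_least[of "\<lambda>\<mu>. limit2 \<mu> \<and> E \<delta> \<mu>" l] limit_of_Ord
    unfolding next_limit2_def by blast
qed

lemma next_limit2D:
  assumes "Ord \<delta>" "next_limit2 \<delta> \<mu>"
  shows "Ord \<mu>" "limit2 \<mu>" "E \<delta> \<mu>" "\<And>x. E x \<mu> \<Longrightarrow> limit2 x \<Longrightarrow> E x \<delta> \<or> x = \<delta>"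
proof -
  show \<mu>: "limit2 \<mu>" "E \<delta> \<mu>" using assms(2) by (simp_all add: next_limit2_def is_least_def)
  show "E x \<delta> \<or> x = \<delta>" if "E x \<mu>" "limit2 x" for x
    using assms that Ord_linear[OF limit_of_Ord[OF that(2)]]
    unfolding next_limit2_def is_least_def by blast
  show "Ord \<mu>" by (rule limit_of_Ord[OF \<mu>(1)])
qed

section \<open>Properties of ordinals expressible in their worlds\<close>

text \<open>The ordinals of the world \<open>V\<^sub>w\<close> are the elements of \<open>w\<close>. Hence \<open>w\<close> may serve as a bound of
  quantifiers in sentences at \<open>V\<^sub>w\<close>, although \<open>w\<close> is not in \<open>V\<^sub>w\<close>. The variable with index \<open>k\<close>
  stands for \<open>w\<close>, the ones with smaller indices for elements of \<open>V\<^sub>w\<close>.\<close>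

definition world_definable :: "nat \<Rightarrow> ((nat \<Rightarrow> 'a) \<Rightarrow> bool) \<Rightarrow> bool" where
  "world_definable k P \<longleftrightarrow>
    definable_on E (Vseg E) {\<beta>. Ord \<beta>} {} k (\<lambda>w s. P (s(k := w)))"

lemma world_definable_cong:
  assumes "world_definable k P"
    and "\<And>s. Ord (s k) \<Longrightarrow> (\<And>i. i < k \<Longrightarrow> s i \<in> Vseg E (s k)) \<Longrightarrow> P s = Q s"
  shows "world_definable k Q"
  using assms(1) unfolding world_definable_def
  by (rule definable_on_cong) (rule assms(2); simp)

lemma world_definable_const: "world_definable k (\<lambda>s. c)"
  and world_definable_not: "world_definable k P \<Longrightarrow> world_definable k (\<lambda>s. \<not> P s)"
  and world_definable_imp:
    "world_definable k P \<Longrightarrow> world_definable k Q \<Longrightarrow> world_definable k (\<lambda>s. P s \<longrightarrow> Q s)"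
  and world_definable_conj:
    "world_definable k P \<Longrightarrow> world_definable k Q \<Longrightarrow> world_definable k (\<lambda>s. P s \<and> Q s)"
  and world_definable_disj:
    "world_definable k P \<Longrightarrow> world_definable k Q \<Longrightarrow> world_definable k (\<lambda>s. P s \<or> Q s)"
  unfolding world_definable_def
  by (simp_all add: definable_on_const definable_on_not definable_on_imp definable_on_conj
      definable_on_disj)

lemmas world_definable_connectives = world_definable_const world_definable_not world_definable_imp
  world_definable_conj world_definable_disj

lemma world_definable_Eql: "i < k \<Longrightarrow> j < k \<Longrightarrow> world_definable k (\<lambda>s. s i = s j)"
  unfolding world_definable_def by (simp add: definable_on_Eql term_function_Var)

lemma definable_on_Vseg_Ord:
  assumes "i < k"
  shows "definable_on E (Vseg E) {\<beta>. Ord \<beta>} {} k (\<lambda>w s. Ord (s i))"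
proof (rule definable_on_cong)
  show "definable_on E (Vseg E) {\<beta>. Ord \<beta>} {} k (\<lambda>w s.
      (\<forall>x\<in>Vseg E w. \<forall>y\<in>Vseg E w. E x y \<and> E y (s i) \<longrightarrow> E x (s i)) \<and>
      (\<forall>z\<in>Vseg E w. E z (s i) \<longrightarrow> (\<forall>x\<in>Vseg E w. \<forall>y\<in>Vseg E w. E x y \<and> E y z \<longrightarrow> E x z)))"
    using assms
    by (intro definable_on_conj definable_on_all definable_on_imp definable_on_Mem
        term_function_Var) simp_all
next
  fix w s assume "w \<in> {\<beta>. Ord \<beta>}" and s: "\<And>j. j < k \<Longrightarrow> s j \<in> Vseg E w"
  then have elements: "y \<in> Vseg E w" if "E y z" "z \<in> Vseg E w" for y z
    using Vseg_transitive that by blast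
  have is_trans_iff: "is_trans E z \<longleftrightarrow>
      (\<forall>x\<in>Vseg E w. \<forall>y\<in>Vseg E w. E x y \<and> E y z \<longrightarrow> E x z)" if "z \<in> Vseg E w" for z
    unfolding is_trans_def using elements[OF _ that] elements by meson
  have "Ord (s i) \<longleftrightarrow> is_trans E (s i) \<and> (\<forall>z\<in>Vseg E w. E z (s i) \<longrightarrow> is_trans E z)"
    unfolding is_Ord_def using elements[OF _ s[OF assms]] by blast
  also have "\<dots> \<longleftrightarrow>
      (\<forall>x\<in>Vseg E w. \<forall>y\<in>Vseg E w. E x y \<and> E y (s i) \<longrightarrow> E x (s i)) \<and>
      (\<forall>z\<in>Vseg E w. E z (s i) \<longrightarrow> (\<forall>x\<in>Vseg E w. \<forall>y\<in>Vseg E w. E x y \<and> E y z \<longrightarrow> E x z))"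
    by (intro conj_cong ball_cong imp_cong refl is_trans_iff s assms)
  finally show "((\<forall>x\<in>Vseg E w. \<forall>y\<in>Vseg E w. E x y \<and> E y (s i) \<longrightarrow> E x (s i)) \<and>
      (\<forall>z\<in>Vseg E w. E z (s i) \<longrightarrow> (\<forall>x\<in>Vseg E w. \<forall>y\<in>Vseg E w. E x y \<and> E y z \<longrightarrow> E x z)))
      = Ord (s i)" by (rule sym)
qed

lemma world_definable_Mem:
  assumes "i < k" "j \<le> k"
  shows "world_definable k (\<lambda>s. E (s i) (s j))"
proof (cases "j = k")
  case True
  have "definable_on E (Vseg E) {\<beta>. Ord \<beta>} {} k (\<lambda>w s. E (s i) w)"
    using definable_on_Vseg_Ord[OF assms(1)]
    by (rule definable_on_cong) (use assms(1) mem_Ord_iff in blast)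
  then show ?thesis using True assms(1) by (simp add: world_definable_def)
next
  case False
  then have "j < k" using assms(2) by simp
  then have "definable_on E (Vseg E) {\<beta>. Ord \<beta>} {} k (\<lambda>w s. E (s i) (s j))"
    by (intro definable_on_Mem term_function_Var assms(1))
  then show ?thesis using False assms(1) by (simp add: world_definable_def)
qed

lemma world_definable_bex:
  assumes "j \<le> k" and Q: "world_definable (Suc k) (\<lambda>s. Q (s 0) (\<lambda>i. s (Suc i)))"
  shows "world_definable k (\<lambda>s. \<exists>x. E x (s j) \<and> Q x s)"
proof -
  have "world_definable (Suc k) (\<lambda>s. E (s 0) (s (Suc j)) \<and> Q (s 0) (\<lambda>i. s (Suc i)))"
    by (rule world_definable_conj[OF world_definable_Mem Q]) (simp_all add: assms(1))
  then have "definable_on E (Vseg E) {\<beta>. Ord \<beta>} {} (Suc k) (\<lambda>w s.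
      E (s 0) (((\<lambda>i. s (Suc i))(k := w)) j) \<and> Q (s 0) ((\<lambda>i. s (Suc i))(k := w)))"
    unfolding world_definable_def by (rule definable_on_cong) (simp add: fun_upd_def)
  from definable_on_ex[where Q = "\<lambda>w x s. E x ((s(k := w)) j) \<and> Q x (s(k := w))", OF this]
  show ?thesis
    unfolding world_definable_def
  proof (rule definable_on_cong)
    fix w s assume w: "w \<in> {\<beta>. Ord \<beta>}" and s: "\<And>i. i < k \<Longrightarrow> s i \<in> Vseg E w"
    have "x \<in> Vseg E w" if "E x ((s(k := w)) j)" for x
    proof (cases "j = k")
      case True
      then show ?thesis using that w mem_Ord_imp_mem_Vseg[of w x] by simp
    next
      case False
      then show ?thesis using that w s[of j] assms(1) Vseg_transitive[of w "s j" x] by simp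
    qed
    then show "(\<exists>x\<in>Vseg E w. E x ((s(k := w)) j) \<and> Q x (s(k := w)))
        = (\<exists>x. E x ((s(k := w)) j) \<and> Q x (s(k := w)))"
      by blast
  qed
qed

lemma world_definable_ball:
  assumes "j \<le> k" "world_definable (Suc k) (\<lambda>s. Q (s 0) (\<lambda>i. s (Suc i)))"
  shows "world_definable k (\<lambda>s. \<forall>x. E x (s j) \<longrightarrow> Q x s)"
  using world_definable_not[OF world_definable_bex[where Q = "\<lambda>x s. \<not> Q x s",
      OF assms(1) world_definable_not[OF assms(2)]]]
  by simp

lemmas world_definable_rules = world_definable_ball world_definable_bex world_definable_Mem
  world_definable_Eql world_definable_connectives

lemma world_definable_Ord:
  assumes "i \<le> k"
  shows "world_definable k (\<lambda>s. Ord (s i))"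
proof -
  have "Ord a \<longleftrightarrow> (\<forall>y. E y a \<longrightarrow> (\<forall>x. E x y \<longrightarrow> E x a)) \<and>
      (\<forall>z. E z a \<longrightarrow> (\<forall>y. E y z \<longrightarrow> (\<forall>x. E x y \<longrightarrow> E x z)))" for a
    unfolding is_Ord_def is_trans_def by blast
  then show ?thesis using assms by (simp only:) (intro world_definable_rules; simp)
qed

lemma world_definable_limit_of:
  assumes "\<And>k i. i \<le> k \<Longrightarrow> world_definable k (\<lambda>s. C (s i))" "i \<le> k"
  shows "world_definable k (\<lambda>s. limit_of C (s i))"
  unfolding limit_of_def using assms(2)
  by (intro world_definable_rules world_definable_Ord assms(1); simp)

lemma world_definable_limit2: "i \<le> k \<Longrightarrow> world_definable k (\<lambda>s. limit2 (s i))"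
  by (intro world_definable_limit_of world_definable_Ord)

primrec iterated_succ :: "nat \<Rightarrow> 'a \<Rightarrow> bool" where
  "iterated_succ 0 \<delta> = True"
| "iterated_succ (Suc j) \<delta> = (\<exists>\<gamma>. \<delta> = succ \<gamma> \<and> iterated_succ j \<gamma>)"

lemma world_definable_iterated_succ:
  "i \<le> k \<Longrightarrow> world_definable k (\<lambda>s. iterated_succ j (s i))"
proof (induction j arbitrary: i k)
  case (Suc j)
  then show ?case
    unfolding iterated_succ.simps succ_eq_iff conj_assoc
    by (intro world_definable_rules Suc.IH; simp)
qed (simp add: world_definable_connectives)

text \<open>At least \<open>k\<close> limits of limits are \<open>\<le> \<delta>\<close>. Including \<open>\<delta>\<close> itself makes the stages half-open
  intervals without a last element.\<close>

primrec passed :: "nat \<Rightarrow> 'a \<Rightarrow> bool" where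
  "passed 0 \<delta> = True"
| "passed (Suc k) \<delta> = (\<exists>\<mu>. (\<mu> = \<delta> \<or> E \<mu> \<delta>) \<and> limit2 \<mu> \<and> (\<exists>\<gamma>. E \<gamma> \<mu> \<and> passed k \<gamma>))"

lemma world_definable_passed: "i \<le> k \<Longrightarrow> world_definable k (\<lambda>s. passed n (s i))"
proof (induction n arbitrary: i k)
  case (Suc n)
  have "passed (Suc n) \<delta> \<longleftrightarrow> limit2 \<delta> \<and> (\<exists>\<gamma>. E \<gamma> \<delta> \<and> passed n \<gamma>) \<or>
      (\<exists>\<mu>. E \<mu> \<delta> \<and> limit2 \<mu> \<and> (\<exists>\<gamma>. E \<gamma> \<mu> \<and> passed n \<gamma>))" for \<delta>
    by auto
  then show ?case
    using Suc by (simp only:) (intro world_definable_rules world_definable_limit2 Suc.IH; simp)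
qed (simp add: world_definable_connectives)

section \<open>The labelling of the worlds\<close>

lemma iterated_succ_Suc_imp: "iterated_succ (Suc j) \<delta> \<Longrightarrow> iterated_succ j \<delta>"
  by (induction j arbitrary: \<delta>) auto

lemma iterated_succ_succ: "iterated_succ (Suc j) (succ \<xi>) \<longleftrightarrow> iterated_succ j \<xi>"
  by (simp add: succ_inject)

lemma passed_mono: "Ord \<delta> \<Longrightarrow> E \<gamma> \<delta> \<Longrightarrow> passed k \<gamma> \<Longrightarrow> passed k \<delta>"
  using Ord_trans[of \<delta> _ \<gamma>] by (cases k) auto

lemma passed_Suc_imp: "Ord \<delta> \<Longrightarrow> passed (Suc k) \<delta> \<Longrightarrow> passed k \<delta>"
  using Ord_trans[of \<delta>] passed_mono[of \<delta> _ k] by auto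

lemma passed_before_next_limit2:
  assumes \<delta>: "Ord \<delta>" and \<mu>: "next_limit2 \<delta> \<mu>" and \<xi>: "E \<delta> \<xi>" "E \<xi> \<mu>"
  shows "passed k \<xi> = passed k \<delta>"
proof
  note \<mu>_Ord = next_limit2D(1)[OF \<delta> \<mu>]
  show "passed k \<xi>" if "passed k \<delta>" using passed_mono[OF Ord_in[OF \<mu>_Ord \<xi>(2)] \<xi>(1) that] .
  have "E x \<delta> \<or> x = \<delta>" if "x = \<xi> \<or> E x \<xi>" "limit2 x" for x
    using next_limit2D(4)[OF \<delta> \<mu> _ that(2)] that(1) Ord_trans[OF \<mu>_Ord _ \<xi>(2)] \<xi>(2) by blast
  then show "passed k \<delta>" if "passed k \<xi>" using that by (cases k) auto
qed

lemma passed_next_limit2: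
  assumes \<delta>: "Ord \<delta>" and \<mu>: "next_limit2 \<delta> \<mu>"
  shows "passed (Suc k) \<mu> = passed k \<delta>"
proof
  note \<mu>_Ord = next_limit2D(1)[OF \<delta> \<mu>]
  show "passed (Suc k) \<mu>" if "passed k \<delta>" using next_limit2D(2,3)[OF \<delta> \<mu>] that by auto
  assume "passed (Suc k) \<mu>"
  then obtain \<gamma> where \<gamma>: "E \<gamma> \<mu>" "passed k \<gamma>" using Ord_trans[OF \<mu>_Ord] by auto
  consider (below) "E \<gamma> \<delta>" | (at) "\<gamma> = \<delta>" | (above) "E \<delta> \<gamma>"
    using Ord_linear[OF Ord_in[OF \<mu>_Ord \<gamma>(1)] \<delta>] by blast
  then show "passed k \<delta>"
  proof cases
    case below
    then show ?thesis using passed_mono[OF \<delta>] \<gamma>(2) by blast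
  next
    case above
    then show ?thesis using passed_before_next_limit2[OF \<delta> \<mu>] \<gamma> by blast
  qed (use \<gamma>(2) in simp)
qed

lemma iterated_succ_before_limit2:
  assumes \<mu>: "limit2 \<mu>" "E \<delta> \<mu>"
  shows "\<exists>\<xi>. E \<delta> \<xi> \<and> E \<xi> \<mu> \<and> iterated_succ j \<xi> \<and> \<not> iterated_succ (Suc j) \<xi>"
proof (induction j)
  case 0
  obtain \<xi> where "E \<xi> \<mu>" "E \<delta> \<xi>" "limit \<xi>" using limit_of_cofinal[OF \<mu>] by blast
  then show ?case using limit_of_neq_succ by auto
next
  case (Suc j)
  then obtain \<xi> where \<xi>: "E \<delta> \<xi>" "E \<xi> \<mu>" "iterated_succ j \<xi>" "\<not> iterated_succ (Suc j) \<xi>" by blast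
  have "E (succ \<xi>) \<mu>" by (rule limit_of_succ_closed[OF \<mu>(1) \<xi>(2)])
  moreover have "E \<delta> (succ \<xi>)" using \<xi>(1) by (simp add: mem_adjoin_iff)
  ultimately show ?case using \<xi>(3,4) iterated_succ_succ by blast
qed

end

definition capped_count :: "nat \<Rightarrow> (nat \<Rightarrow> bool) \<Rightarrow> nat" where
  "capped_count n P = Max {k. k \<le> n \<and> P k}"

lemma capped_count_eq_iff:
  assumes "P 0" and antitone: "\<And>k. P (Suc k) \<Longrightarrow> P k"
  shows "capped_count n P = i \<longleftrightarrow> i \<le> n \<and> P i \<and> (i = n \<or> \<not> P (Suc i))"
proof
  let ?A = "{k. k \<le> n \<and> P k}"
  assume "capped_count n P = i"
  then have i: "i = Max ?A" by (simp add: capped_count_def)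
  have "i \<in> ?A" unfolding i by (rule Max_in) (use assms(1) in auto)
  moreover have "Suc i \<notin> ?A"
  proof
    assume "Suc i \<in> ?A"
    then have "Suc i \<le> Max ?A" by (intro Max_ge) auto
    then show False using i by simp
  qed
  ultimately show "i \<le> n \<and> P i \<and> (i = n \<or> \<not> P (Suc i))" by auto
next
  assume i: "i \<le> n \<and> P i \<and> (i = n \<or> \<not> P (Suc i))"
  have "k \<le> i" if k: "k \<le> n" "P k" for k
  proof (rule ccontr)
    assume "\<not> k \<le> i"
    then have "Suc i \<le> k" by simp
    then have "P (Suc i)" using k(2) by (rule inc_induct) (rule antitone)
    then show False using i k(1) \<open>Suc i \<le> k\<close> by simp
  qed
  then show "capped_count n P = i" unfolding capped_count_def using i by (intro Max_eqI) auto
qed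

lemma capped_count_mono:
  assumes "P 0" "\<And>k. P k \<Longrightarrow> Q k"
  shows "capped_count n P \<le> capped_count n Q"
  unfolding capped_count_def using assms by (intro Max_mono) auto

lemma capped_count_le: "P 0 \<Longrightarrow> capped_count n P \<le> n"
  unfolding capped_count_def by (subst Max_le_iff) auto

context ZFC
begin

definition stage :: "nat \<Rightarrow> 'a \<Rightarrow> nat" where
  "stage n \<delta> = capped_count n (\<lambda>k. passed k \<delta>)"

definition dial :: "nat \<Rightarrow> 'a \<Rightarrow> nat" where
  "dial N \<delta> = capped_count N (\<lambda>j. iterated_succ j \<delta>)"

lemma stage_eq_iff:
  "Ord \<delta> \<Longrightarrow> stage n \<delta> = i \<longleftrightarrow> i \<le> n \<and> passed i \<delta> \<and> (i = n \<or> \<not> passed (Suc i) \<delta>)"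
  unfolding stage_def by (rule capped_count_eq_iff) (simp, rule passed_Suc_imp)

lemma dial_eq_iff:
  "dial N \<delta> = j \<longleftrightarrow> j \<le> N \<and> iterated_succ j \<delta> \<and> (j = N \<or> \<not> iterated_succ (Suc j) \<delta>)"
  unfolding dial_def by (rule capped_count_eq_iff) (simp, rule iterated_succ_Suc_imp)

lemma stage_le: "stage n \<delta> \<le> n"
  unfolding stage_def by (rule capped_count_le) simp

lemma dial_le: "dial N \<delta> \<le> N"
  unfolding dial_def by (rule capped_count_le) simp

lemma stage_mono: "ord_le E \<gamma> \<delta> \<Longrightarrow> stage n \<gamma> \<le> stage n \<delta>"
  unfolding stage_def by (rule capped_count_mono) (auto simp: ord_le_def intro: passed_mono)

lemma stage_empty:
  assumes "\<And>x. \<not> E x \<beta>"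
  shows "stage n \<beta> = 0"
  using stage_eq_iff[OF Ord_empty[OF assms], of n 0] assms by (auto simp: limit_of_def)

lemma dial_empty: "(\<And>x. \<not> E x \<beta>) \<Longrightarrow> dial N \<beta> = 0"
  by (auto simp: dial_eq_iff succ_eq_iff)

lemma stage_next_limit2:
  assumes "Ord \<delta>" "next_limit2 \<delta> \<mu>" "stage n \<delta> < n"
  shows "stage n \<mu> = Suc (stage n \<delta>)"
  using stage_eq_iff[OF assms(1), of n "stage n \<delta>"] assms(3) passed_next_limit2[OF assms(1,2)]
  by (subst stage_eq_iff[OF next_limit2D(1)[OF assms(1,2)]]) (auto simp del: passed.simps(2))

lemma reach_stage:
  assumes "Ord \<delta>" "stage n \<delta> \<le> i" "i \<le> n"
  shows "\<exists>\<xi>. ord_le E \<delta> \<xi> \<and> stage n \<xi> = i"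
  using assms(2,3)
proof (induction i rule: dec_induct)
  case base
  then show ?case using assms(1) by (auto simp: ord_le_def)
next
  case (step i)
  then obtain \<xi> where \<xi>: "ord_le E \<delta> \<xi>" "stage n \<xi> = i" by auto
  then have "Ord \<xi>" by (simp add: ord_le_def)
  then obtain \<mu> where \<mu>: "next_limit2 \<xi> \<mu>" by (rule next_limit2_exists)
  have "ord_le E \<xi> \<mu>" using next_limit2D(1,3)[OF \<open>Ord \<xi>\<close> \<mu>] \<open>Ord \<xi>\<close> by (simp add: ord_le_def)
  moreover have "stage n \<mu> = Suc i"
    using stage_next_limit2[OF \<open>Ord \<xi>\<close> \<mu>] \<xi>(2) step.prems by simp
  ultimately show ?case using ord_le_trans[OF \<xi>(1)] by blast
qed

lemma reach_dial:
  assumes \<delta>: "Ord \<delta>" and "j \<le> N"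
  shows "\<exists>\<xi>. ord_le E \<delta> \<xi> \<and> stage n \<xi> = stage n \<delta> \<and> dial N \<xi> = j"
proof -
  obtain \<mu> where \<mu>: "next_limit2 \<delta> \<mu>" using \<delta> by (rule next_limit2_exists)
  obtain \<xi> where \<xi>: "E \<delta> \<xi>" "E \<xi> \<mu>" "iterated_succ j \<xi>" "\<not> iterated_succ (Suc j) \<xi>"
    using iterated_succ_before_limit2[OF next_limit2D(2,3)[OF \<delta> \<mu>]] by blast
  have "ord_le E \<delta> \<xi>"
    using \<delta> \<xi>(1) Ord_in[OF next_limit2D(1)[OF \<delta> \<mu>] \<xi>(2)] by (simp add: ord_le_def)
  moreover have "stage n \<xi> = stage n \<delta>"
    by (simp add: stage_def passed_before_next_limit2[OF \<delta> \<mu> \<xi>(1,2)])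
  moreover have "dial N \<xi> = j" using \<xi>(3,4) assms(2) by (simp add: dial_eq_iff)
  ultimately show ?thesis by blast
qed

lemma bounded_morphism_stage_dial:
  "bounded_morphism_on {\<delta>. Ord \<delta>} (ord_le E) (cluster_chain ({..n} \<times> {..N}) fst)
    (\<lambda>\<delta>. (stage n \<delta>, dial N \<delta>))"
  unfolding bounded_morphism_on_def
proof (intro conjI ballI allI impI)
  fix \<delta> \<xi> assume "\<delta> \<in> {\<delta>. Ord \<delta>}" "ord_le E \<delta> \<xi>"
  then show "\<xi> \<in> {\<delta>. Ord \<delta>}"
    "cluster_chain ({..n} \<times> {..N}) fst (stage n \<delta>, dial N \<delta>) (stage n \<xi>, dial N \<xi>)"
    using stage_mono stage_le dial_le by (auto simp: ord_le_def cluster_chain_def)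
next
  fix \<delta> u assume \<delta>: "\<delta> \<in> {\<delta>. Ord \<delta>}"
    and "cluster_chain ({..n} \<times> {..N}) fst (stage n \<delta>, dial N \<delta>) u"
  then obtain i j where u: "u = (i, j)" "stage n \<delta> \<le> i" "i \<le> n" "j \<le> N"
    by (auto simp: cluster_chain_def)
  obtain \<zeta> where \<zeta>: "ord_le E \<delta> \<zeta>" "stage n \<zeta> = i" using reach_stage[of \<delta>] \<delta> u(2,3) by blast
  then have "Ord \<zeta>" by (simp add: ord_le_def)
  then obtain \<xi> where "ord_le E \<zeta> \<xi>" "stage n \<xi> = i" "dial N \<xi> = j"
    using reach_dial[of \<zeta> j N n] u(4) \<zeta>(2) by blast
  then show "\<exists>\<xi>. ord_le E \<delta> \<xi> \<and> (stage n \<xi>, dial N \<xi>) = u" using ord_le_trans[OF \<zeta>(1)] u(1) by blast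
qed

lemma stage_dial_sentence:
  "\<exists>\<phi>\<in>L_set. \<forall>R w s. Ord w \<longrightarrow> sat E (Vseg E) R w s \<phi> = U (stage n w) (dial N w)"
proof -
  have stage: "world_definable 0 (\<lambda>s. stage n (s 0) = i)" for i
  proof (rule world_definable_cong)
    show "world_definable 0 (\<lambda>s. i \<le> n \<and> passed i (s 0) \<and> (i = n \<or> \<not> passed (Suc i) (s 0)))"
      by (intro world_definable_connectives world_definable_passed order_refl)
  qed (simp only: stage_eq_iff)
  have dial: "world_definable 0 (\<lambda>s. dial N (s 0) = j)" for j
    unfolding dial_eq_iff
    by (intro world_definable_connectives world_definable_iterated_succ order_refl)
  have "world_definable 0 (\<lambda>s. \<exists>i\<in>{..n}. \<exists>j\<in>{..N}. U i j \<and> stage n (s 0) = i \<and> dial N (s 0) = j)"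
    using stage dial world_definable_const unfolding world_definable_def
    by (intro definable_on_finite_ex definable_on_conj) auto
  then have "world_definable 0 (\<lambda>s. U (stage n (s 0)) (dial N (s 0)))"
    by (rule world_definable_cong) (use stage_le dial_le in auto)
  then show ?thesis by (auto simp: world_definable_def definable_on_def L_set_def)
qed

section \<open>The modal logic of rank potentialism\<close>

lemma Val_rank_sound:
  assumes "Ord \<beta>" "p \<in> S43"
  shows "p \<in> Val_rank E \<beta> L"
proof -
  have "holds (ord_le E) V \<beta> p" for V
  proof (rule S43_sound[OF assms(2), where A = "{\<beta>. Ord \<beta>}"])
    show "reflp_on {\<beta>. Ord \<beta>} (ord_le E)" by (auto intro: reflp_onI simp: ord_le_def)
    show "transp_on {\<beta>. Ord \<beta>} (ord_le E)" using ord_le_trans by (blast intro: transp_onI)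
    show "ord_le E u v \<or> ord_le E v u" if "ord_le E w u" "ord_le E w v" for u v w
      using that Ord_linear[of u v] by (auto simp: ord_le_def)
  qed (use assms(1) in \<open>auto simp: ord_le_def\<close>)
  then show ?thesis by (simp add: Val_def sat_inst)
qed

lemma Val_rank_complete:
  assumes empty: "\<And>x. \<not> E x \<beta>" and valid: "p \<in> Val_rank E \<beta> L_set"
  shows "p \<in> S43"
proof (rule ccontr)
  assume "p \<notin> S43"
  then obtain n N V where
    countermodel: "\<not> holds (cluster_chain ({..n} \<times> {..N}) fst) V (0::nat, 0::nat) p"
    by (rule S43_grid_countermodel)
  have "\<forall>m. \<exists>\<phi>. \<phi> \<in> L_set \<and>
      (\<forall>R w s. Ord w \<longrightarrow> sat E (Vseg E) R w s \<phi> = V (stage n w, dial N w) m)"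
    using stage_dial_sentence[where U = "\<lambda>i j. V (i, j) _"] by blast
  then obtain \<sigma> where \<sigma>: "\<And>m. \<sigma> m \<in> L_set"
      "\<And>R w s m. Ord w \<Longrightarrow> sat E (Vseg E) R w s (\<sigma> m) = V (stage n w, dial N w) m"
    by metis
  have "holds (ord_le E) (\<lambda>w m. sat E (Vseg E) (ord_le E) w s (\<sigma> m)) \<beta> p
      = holds (cluster_chain ({..n} \<times> {..N}) fst) V (stage n \<beta>, dial N \<beta>) p" for s
    using Ord_empty[OF empty] \<sigma>(2)
    by (intro holds_bounded_morphism[OF bounded_morphism_stage_dial]) auto
  then have "\<not> sat E (Vseg E) (ord_le E) \<beta> s (inst \<sigma> p)" for s
    using countermodel stage_empty[OF empty] dial_empty[OF empty] by (simp add: sat_inst)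
  then show False using valid \<sigma>(1) by (auto simp: Val_def)
qed

end

theorem theorem9:
  fixes E :: "'a \<Rightarrow> 'a \<Rightarrow> bool"
  assumes "ZFC E"
  shows "\<exists>\<beta>. is_Ord E \<beta> \<and>
    S43 = Val_rank E \<beta> (L_set_dia (Vseg E \<beta>)) \<and>
    Val_rank E \<beta> (L_set_dia (Vseg E \<beta>)) = Val_rank E \<beta> L_set"
proof -
  interpret ZFC E by (rule assms)
  obtain \<beta> where empty: "\<And>x. \<not> E x \<beta>" using infinity by blast
  have \<beta>: "is_Ord E \<beta>" using empty by (rule Ord_empty)
  have "S43 \<subseteq> Val_rank E \<beta> (L_set_dia (Vseg E \<beta>))"
    using Val_rank_sound[OF \<beta>] by blast
  moreover have "Val_rank E \<beta> (L_set_dia (Vseg E \<beta>)) \<subseteq> Val_rank E \<beta> L_set"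
    by (auto simp: Val_def L_set_def L_set_dia_def)
  moreover have "Val_rank E \<beta> L_set \<subseteq> S43"
    using Val_rank_complete[OF empty] by blast
  ultimately show ?thesis using \<beta> by blast
qed

end
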